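(* Let $w\in S_n$ be a fireworks permutation and write $\pi(w)\in S_n$ for the layered permutation whose block sizes are the lengths of the descending runs of $w$ (in order from left to right). Then $\mathrm{supp}(\mathfrak G_{\pi(w)})\supseteq\mathrm{supp}(\mathfrak G_w)$.
   Context: Notation: permutations are in one-line notation; $\ell(w)$ is the number of inversions; $w_0$ is the longest element of $S_n$; $s_i$ is the adjacent transposition $(i\ i+1)$. The descending (decreasing) runs of $w$ are the maximal decreasing strings of consecutive entries $w(a)>w(a+1)>\dots>w(b)$. Fireworks: $w\in S_n$ is fireworks if the initial terms of its decreasing runs are increasing from left to right. Equivalently, there are no $i<j$ with $w(j)<w(j+1)<w(i)$. Layered: given positive integers $b_1,\dots,b_m$ with sum $n$, set $c_i=b_1+\dots+b_i$; the layered permutation with block sizes $(b_1,\dots,b_m)$ is the permutation with one-line notation $c_1\,(c_1-1)\cdots1\;\;c_2\,(c_2-1)\cdots(c_1+1)\;\cdots\;c_m\,(c_m-1)\cdots(c_{m-1}+1)$. Grothendieck polynomials: for $1\le i\le n-1$ and $f\in\mathbb Z[x_1,\dots,x_n]$ let $\partial_i(f)=\frac{f-s_if}{x_i-x_{i+1}}$, where $s_i$ acts by switching $x_i$ and $x_{i+1}$, and $\overline\partial_i(f)=\partial_i((1-x_{i+1})f)$. Then $\mathfrak G_{w_0}=x_1^{n-1}x_2^{n-2}\cdots x_{n-1}$ and $\mathfrak G_w=\overline\partial_i(\mathfrak G_{ws_i})$ whenever $\ell(w)<\ell(ws_i)$. $\mathrm{supp}(f)\subset\mathbb Z_{\ge0}^n$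 is the set of exponent vectors of monomials with nonzero coefficient in $f$. *)

theory Defs
  imports "HOL-Library.Poly_Mapping" "HOL-Combinatorics.Permutations"
begin

section \<open>Permutations of \<open>{1..n}\<close>\<close>

text \<open>Elements of $S_n$ are functions \<open>w\<close> with \<open>w permutes {1..n}\<close>; products are
  compositions, so \<open>w \<circ> transpose i (Suc i)\<close> is $w s_i$, which exchanges the entries of the
  one-line notation in positions $i$ and $i+1$.\<close>

definition one_line :: "nat \<Rightarrow> (nat \<Rightarrow> nat) \<Rightarrow> nat list" where
  "one_line n w = map w [1..<Suc n]"

definition perm_of_word :: "nat list \<Rightarrow> nat \<Rightarrow> nat" where
  "perm_of_word xs i = (if i \<in> {1..length xs} then xs ! (i - 1) else i)"

definition inversion_set :: "nat \<Rightarrow> (nat \<Rightarrow> nat) \<Rightarrow> (nat \<times> nat) set" where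
  "inversion_set n w = {(i, j). 1 \<le> i \<and> i < j \<and> j \<le> n \<and> w i > w j}"

definition perm_length :: "nat \<Rightarrow> (nat \<Rightarrow> nat) \<Rightarrow> nat" where
  "perm_length n w = card (inversion_set n w)"

definition longest_perm :: "nat \<Rightarrow> nat \<Rightarrow> nat" where
  "longest_perm n i = (if i \<in> {1..n} then Suc n - i else i)"

fun desc_runs :: "'a::linorder list \<Rightarrow> 'a list list" where
  "desc_runs [] = []"
| "desc_runs (x # xs) =
     (case desc_runs xs of
        [] \<Rightarrow> [[x]]
      | r # rs \<Rightarrow> if x > hd r then (x # r) # rs else [x] # r # rs)"

definition fireworks :: "nat \<Rightarrow> (nat \<Rightarrow> nat) \<Rightarrow> bool" where
  "fireworks n w \<longleftrightarrow> sorted_wrt (<) (map hd (desc_runs (one_line n w)))"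

text \<open>With $c_i = b_1 + \dots + b_i$ (and $c_0 = 0$), the $i$-th block (counted from \<open>0\<close>) of the
  layered word is $c_{i+1}, c_{i+1} - 1, \dots, c_i + 1$.\<close>

definition layered_word :: "nat list \<Rightarrow> nat list" where
  "layered_word bs =
     concat (map (\<lambda>i. rev [Suc (sum_list (take i bs))..<Suc (sum_list (take (Suc i) bs))])
       [0..<length bs])"

definition layered_perm :: "nat list \<Rightarrow> nat \<Rightarrow> nat" where
  "layered_perm bs = perm_of_word (layered_word bs)"

definition fireworks_layered :: "nat \<Rightarrow> (nat \<Rightarrow> nat) \<Rightarrow> nat \<Rightarrow> nat" where
  "fireworks_layered n w = layered_perm (map length (desc_runs (one_line n w)))"


section \<open>Grothendieck polynomials\<close>

text \<open>Integer polynomials in variables $x_0, x_1, x_2, \dots$; an exponent vector is a finitely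
  supported function \<open>nat \<Rightarrow>\<^sub>0 nat\<close>, and the support of \<open>f\<close> is \<open>Poly_Mapping.keys f\<close>.
  Polynomials in $x_1, \dots, x_n$ are those whose exponent vectors vanish outside \<open>{1..n}\<close>;
  the Grothendieck polynomials below for $S_n$ are of this kind.\<close>

type_synonym int_mpoly = "(nat \<Rightarrow>\<^sub>0 nat) \<Rightarrow>\<^sub>0 int"

definition X :: "nat \<Rightarrow> int_mpoly" where
  "X i = Poly_Mapping.single (Poly_Mapping.single i 1) 1"

text \<open>The action of $s_i$: the coefficient of $x^e$ in $s_i f$ is that of $x^{e \circ s_i}$
  in $f$.\<close>

definition swap_vars :: "nat \<Rightarrow> int_mpoly \<Rightarrow> int_mpoly" where
  "swap_vars i f = Poly_Mapping.map_key (Poly_Mapping.map_key (transpose i (Suc i))) f"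

text \<open>The polynomial quotient exists and is unique; see \<open>div_diff_eq\<close> and
  \<open>div_diff_unique\<close> below.\<close>

definition div_diff :: "nat \<Rightarrow> int_mpoly \<Rightarrow> int_mpoly" where
  "div_diff i f = (THE g. (X i - X (Suc i)) * g = f - swap_vars i f)"

definition iso_div_diff :: "nat \<Rightarrow> int_mpoly \<Rightarrow> int_mpoly" where
  "iso_div_diff i f = div_diff i ((1 - X (Suc i)) * f)"

inductive is_grothendieck :: "nat \<Rightarrow> (nat \<Rightarrow> nat) \<Rightarrow> int_mpoly \<Rightarrow> bool" for n :: nat where
  longest: "is_grothendieck n (longest_perm n) (\<Prod>i=1..n. X i ^ (n - i))"
| ascent: "is_grothendieck n w (iso_div_diff i f)"
    if "w permutes {1..n}" "1 \<le> i" "i < n"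
      "perm_length n w < perm_length n (w \<circ> transpose i (Suc i))"
      "is_grothendieck n (w \<circ> transpose i (Suc i)) f"

text \<open>The result does not depend on the chain of ascents; see \<open>is_grothendieck_ex1\<close>,
  \<open>grothendieck_longest_perm\<close> and \<open>grothendieck_ascent\<close> below.\<close>

definition grothendieck :: "nat \<Rightarrow> (nat \<Rightarrow> nat) \<Rightarrow> int_mpoly" where
  "grothendieck n w = (THE f. is_grothendieck n w f)"


section \<open>Well-definedness\<close>

lemma concat_desc_runs: "concat (desc_runs xs) = xs"
  by (induction xs) (auto split: list.split)

lemma desc_runs_nonempty: "r \<in> set (desc_runs xs) \<Longrightarrow> r \<noteq> []"
  by (induction xs arbitrary: r) (auto split: list.splits if_splits)

lemma desc_runs_decreasing: "r \<in> set (desc_runs xs) \<Longrightarrow> sorted_wrt (>) r"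
proof (induction xs arbitrary: r)
  case (Cons x xs)
  have "sorted_wrt (>) (x # s)" if "s \<in> set (desc_runs xs)" "x > hd s" for s
    using Cons.IH[OF that(1)] that(2) by (cases s) force+
  then have "sorted_wrt (>) (x # s)" if "desc_runs xs = s # rs" "x > hd s" for s rs
    using that by (metis list.set_intros(1))
  with Cons show ?case by (auto simp add: sorted_wrt1 simp del: sorted_wrt.simps(2) split: list.splits if_splits)
qed simp

lemma desc_runs_maximal: "successively (\<lambda>r s. last r \<le> hd s) (desc_runs xs)"
proof (induction xs)
  case (Cons x xs)
  then show ?case
    using desc_runs_nonempty[of _ xs]
    by (fastforce simp: successively_Cons split: list.split)
qed simp

lemma inj_map_key_transpose: "inj (Poly_Mapping.map_key (transpose i j) :: (nat \<Rightarrow>\<^sub>0 nat) \<Rightarrow> _)"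
proof (rule injI)
  fix p q :: "nat \<Rightarrow>\<^sub>0 nat"
  assume "Poly_Mapping.map_key (transpose i j) p = Poly_Mapping.map_key (transpose i j) q"
  then have "Poly_Mapping.map_key (transpose i j) (Poly_Mapping.map_key (transpose i j) p)
    = Poly_Mapping.map_key (transpose i j) (Poly_Mapping.map_key (transpose i j) q)" by simp
  then show "p = q"
    by (simp add: map_key_compose map_key_id[unfolded id_def[symmetric]])
qed

lemma map_key_transpose_twice:
  "Poly_Mapping.map_key (transpose i j) (Poly_Mapping.map_key (transpose i j) p) = p"
  by (simp add: map_key_compose map_key_id[unfolded id_def[symmetric]])

lemma swap_vars_lookup:
  "Poly_Mapping.lookup (swap_vars i f) e =
     Poly_Mapping.lookup f (Poly_Mapping.map_key (transpose i (Suc i)) e)"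
  unfolding swap_vars_def by (simp add: map_key.rep_eq[OF inj_map_key_transpose])

lemma swap_vars_0 [simp]: "swap_vars i 0 = 0"
  unfolding swap_vars_def by (rule map_key_zero[OF inj_map_key_transpose])

lemma swap_vars_single [simp]:
  "swap_vars i (Poly_Mapping.single e c) =
     Poly_Mapping.single (Poly_Mapping.map_key (transpose i (Suc i)) e) c"
  using map_key_single[OF inj_map_key_transpose, of i "Suc i"
      "Poly_Mapping.map_key (transpose i (Suc i)) e" c]
  by (simp add: swap_vars_def map_key_transpose_twice)

lemma swap_vars_add [simp]: "swap_vars i (f + g) = swap_vars i f + swap_vars i g"
  by (rule poly_mapping_eqI) (simp add: swap_vars_lookup lookup_add)

lemma swap_vars_diff [simp]: "swap_vars i (f - g) = swap_vars i f - swap_vars i g"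
  by (rule poly_mapping_eqI) (simp add: swap_vars_lookup lookup_minus)

lemma swap_vars_twice [simp]: "swap_vars i (swap_vars i f) = f"
  by (rule poly_mapping_eqI) (simp add: swap_vars_lookup map_key_transpose_twice)

lemma swap_vars_mult [simp]: "swap_vars i (f * g) = swap_vars i f * swap_vars i g"
proof -
  have "Poly_Mapping.keys f \<subseteq> UNIV" by simp
  then show ?thesis
  proof (induction f rule: frag_induction)
    case (one d)
    have "Poly_Mapping.keys g \<subseteq> UNIV" by simp
    then show ?case
    proof (induction g rule: frag_induction)
      case (one e)
      then show ?case by (simp add: mult_single map_key_plus)
    qed (simp_all add: algebra_simps)
  qed (simp_all add: algebra_simps)
qed

lemma swap_vars_1 [simp]: "swap_vars i 1 = 1"
  by (simp flip: single_one)

lemma swap_vars_X: "swap_vars i (X k) = X (transpose i (Suc i) k)"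
  using map_key_single[of "transpose i (Suc i)" "transpose i (Suc i) k" "1::nat"]
  by (simp add: X_def)

lemma X_eq_iff: "X i = X j \<longleftrightarrow> i = j"
proof
  assume "X i = X j"
  then have "Poly_Mapping.keys (X i) = Poly_Mapping.keys (X j)" by simp
  then have "Poly_Mapping.keys (Poly_Mapping.single i (1::nat)) = Poly_Mapping.keys (Poly_Mapping.single j (1::nat))"
    by (simp add: X_def)
  then show "i = j" by simp
qed simp

lemma dvd_swap_vars_mult:
  assumes "d dvd f - swap_vars i f" "d dvd g - swap_vars i g"
  shows "d dvd f * g - swap_vars i (f * g)"
proof -
  have "f * g - swap_vars i (f * g) = (f - swap_vars i f) * g + swap_vars i f * (g - swap_vars i g)"
    by (simp add: algebra_simps)
  then show ?thesis using assms by simp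
qed

lemma dvd_swap_vars_X: "X i - X (Suc i) dvd X k - swap_vars i (X k)"
proof -
  consider "k = i" | "k = Suc i" | "k \<noteq> i" "k \<noteq> Suc i" by blast
  then show ?thesis
  proof cases
    case 2
    have "X (Suc i) - X i = - (X i - X (Suc i))" by simp
    then show ?thesis using 2 by (metis swap_vars_X transpose_apply_second dvd_refl dvd_minus_iff)
  qed (simp_all add: swap_vars_X)
qed

lemma dvd_swap_vars_monomial:
  "X i - X (Suc i) dvd
     Poly_Mapping.single e 1 - swap_vars i (Poly_Mapping.single e 1)"
proof (induction e rule: update_induct)
  case const
  then show ?case by (simp del: swap_vars_single)
next
  case (update e k v)
  have pow: "X i - X (Suc i) dvd X k ^ m - swap_vars i (X k ^ m)" for m
  proof (induction m)
    case (Suc m)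
    then show ?case using dvd_swap_vars_mult[OF dvd_swap_vars_X Suc] by simp
  qed simp
  have X_pow: "X k ^ m = Poly_Mapping.single (Poly_Mapping.single k m) 1" for m
    by (induction m) (simp_all add: X_def mult_single flip: single_add)
  have "Poly_Mapping.update k v e = Poly_Mapping.single k v + e"
    using update(1) by (intro poly_mapping_eqI)
      (auto simp: lookup_update lookup_add lookup_single when_def in_keys_iff)
  then have "Poly_Mapping.single (Poly_Mapping.update k v e) 1 = X k ^ v * Poly_Mapping.single e 1"
    by (simp add: X_pow mult_single)
  then show ?case using dvd_swap_vars_mult[OF pow update(3)] by metis
qed

lemma dvd_swap_vars: "X i - X (Suc i) dvd f - swap_vars i f"
proof -
  have "Poly_Mapping.keys f \<subseteq> UNIV" by simp
  then show ?thesis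
  proof (induction f rule: frag_induction)
    case (one e)
    then show ?case using dvd_swap_vars_monomial by simp
  next
    case (diff f g)
    have "f - g - swap_vars i (f - g) = (f - swap_vars i f) - (g - swap_vars i g)" by simp
    then show ?case using diff by (metis dvd_diff)
  qed simp
qed

lemma div_diff_unique:
  assumes "(X i - X (Suc i)) * g = f - swap_vars i f"
  shows "div_diff i f = g"
  unfolding div_diff_def
proof (rule the_equality)
  fix h assume "(X i - X (Suc i)) * h = f - swap_vars i f"
  with assms have "(X i - X (Suc i)) * h = (X i - X (Suc i)) * g" by simp
  then show "h = g" by (simp add: X_eq_iff)
qed (use assms in simp)

lemma div_diff_eq: "(X i - X (Suc i)) * div_diff i f = f - swap_vars i f"
proof -
  obtain g where "f - swap_vars i f = (X i - X (Suc i)) * g"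
    using dvd_swap_vars[of i f] by (auto simp: dvd_def)
  then show ?thesis using div_diff_unique[of i g f] by simp
qed

lemma iso_div_diff_eq:
  "(X i - X (Suc i)) * iso_div_diff i f = (1 - X (Suc i)) * f - (1 - X i) * swap_vars i f"
  by (simp add: iso_div_diff_def div_diff_eq swap_vars_X)

lemma swap_vars_iso_div_diff:
  assumes "X (transpose j (Suc j) i) = a" "X (transpose j (Suc j) (Suc i)) = b"
  shows "(a - b) * swap_vars j (iso_div_diff i f) =
    (1 - b) * swap_vars j f - (1 - a) * swap_vars j (swap_vars i f)"
  using arg_cong[OF iso_div_diff_eq[of i f], of "swap_vars j"] assms
  by (simp add: swap_vars_X)

lemma swap_vars_commute:
  assumes "Suc i < j"
  shows "swap_vars i (swap_vars j f) = swap_vars j (swap_vars i f)"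
proof -
  have "transpose i (Suc i) \<circ> transpose j (Suc j) = transpose j (Suc j) \<circ> transpose i (Suc i)"
    using assms by (auto simp: fun_eq_iff transpose_def)
  then show ?thesis
    by (intro poly_mapping_eqI) (simp add: swap_vars_lookup map_key_compose)
qed

lemma transpose_braid:
  fixes i :: nat
  shows "transpose i (Suc i) \<circ> transpose (Suc i) (Suc (Suc i)) \<circ> transpose i (Suc i) =
    transpose (Suc i) (Suc (Suc i)) \<circ> transpose i (Suc i) \<circ> transpose (Suc i) (Suc (Suc i))"
  by (auto simp: fun_eq_iff transpose_def)

lemma swap_vars_braid:
  "swap_vars i (swap_vars (Suc i) (swap_vars i f)) =
   swap_vars (Suc i) (swap_vars i (swap_vars (Suc i) f))"
  using transpose_braid[of i]
  by (intro poly_mapping_eqI)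
    (simp add: swap_vars_lookup map_key_compose inj_compose comp_assoc)

lemma iso_div_diff_commute:
  assumes "Suc i < j"
  shows "iso_div_diff i (iso_div_diff j f) = iso_div_diff j (iso_div_diff i f)"
proof -
  define a b c d where "a = X i" "b = X (Suc i)" "c = X j" "d = X (Suc j)"
  note defs = this
  have nz: "a - b \<noteq> 0" "c - d \<noteq> 0" by (simp_all add: defs X_eq_iff)
  define g h where "g = iso_div_diff j f" "h = iso_div_diff i f"
  note gh = this
  have 1: "(c - d) * g = (1 - d) * f - (1 - c) * swap_vars j f"
    "(a - b) * h = (1 - b) * f - (1 - a) * swap_vars i f"
    "(a - b) * iso_div_diff i g = (1 - b) * g - (1 - a) * swap_vars i g"
    "(c - d) * iso_div_diff j h = (1 - d) * h - (1 - c) * swap_vars j h"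
    by (simp_all add: defs gh iso_div_diff_eq)
  have 2: "(c - d) * swap_vars i g =
      (1 - d) * swap_vars i f - (1 - c) * swap_vars i (swap_vars j f)"
    "(a - b) * swap_vars j h =
      (1 - b) * swap_vars j f - (1 - a) * swap_vars i (swap_vars j f)"
    using assms swap_vars_iso_div_diff[of i j c d f] swap_vars_iso_div_diff[of j i a b f]
    by (simp_all add: defs gh transpose_def swap_vars_commute[OF assms])
  have "(a - b) * (c - d) * iso_div_diff i g =
      (1 - b) * ((c - d) * g) - (1 - a) * ((c - d) * swap_vars i g)"
    using 1(3) by algebra
  also have "\<dots> = (1 - d) * ((a - b) * h) - (1 - c) * ((a - b) * swap_vars j h)"
    unfolding 1 2 by (simp add: algebra_simps)
  also have "\<dots> = (a - b) * (c - d) * iso_div_diff j h"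
    using 1(4) by algebra
  finally show ?thesis using nz by (simp add: gh)
qed

lemma iso_div_diff_braid:
  "iso_div_diff i (iso_div_diff (Suc i) (iso_div_diff i f)) =
   iso_div_diff (Suc i) (iso_div_diff i (iso_div_diff (Suc i) f))"
proof -
  let ?j = "Suc i"
  define a b c where "a = X i" "b = X (Suc i)" "c = X (Suc (Suc i))"
  note defs = this
  have nz: "a - b \<noteq> 0" "b - c \<noteq> 0" "a - c \<noteq> 0" by (simp_all add: defs X_eq_iff)
  have D1: "(a - b) * iso_div_diff i p = (1 - b) * p - (1 - a) * swap_vars i p"
    and D2: "(b - c) * iso_div_diff ?j p = (1 - c) * p - (1 - b) * swap_vars ?j p" for p
    by (simp_all add: defs iso_div_diff_eq)
  have S21: "(a - c) * swap_vars ?j (iso_div_diff i p) =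
      (1 - c) * swap_vars ?j p - (1 - a) * swap_vars ?j (swap_vars i p)"
    and S12: "(a - c) * swap_vars i (iso_div_diff ?j p) =
      (1 - c) * swap_vars i p - (1 - a) * swap_vars i (swap_vars ?j p)" for p
    by (auto simp: defs transpose_def intro!: swap_vars_iso_div_diff)
  have S11: "swap_vars i (iso_div_diff i p) = iso_div_diff i p" for p
  proof -
    have "(b - a) * swap_vars i (iso_div_diff i p) = (1 - a) * swap_vars i p - (1 - b) * p"
      using swap_vars_iso_div_diff[of i i b a p] by (simp add: defs)
    also have "\<dots> = - ((a - b) * iso_div_diff i p)" by (simp add: D1)
    also have "\<dots> = (b - a) * iso_div_diff i p" by (simp add: algebra_simps)
    finally show ?thesis using nz by simp
  qed
  have S22: "swap_vars ?j (iso_div_diff ?j p) = iso_div_diff ?j p" for p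
  proof -
    have "(c - b) * swap_vars ?j (iso_div_diff ?j p) = (1 - b) * swap_vars ?j p - (1 - c) * p"
      using swap_vars_iso_div_diff[of ?j ?j c b p] by (simp add: defs)
    also have "\<dots> = - ((b - c) * iso_div_diff ?j p)" by (simp add: D2)
    also have "\<dots> = (c - b) * iso_div_diff ?j p" by (simp add: algebra_simps)
    finally show ?thesis using nz by simp
  qed
  have S121: "(b - c) * swap_vars i (swap_vars ?j (iso_div_diff i p)) =
      (1 - c) * swap_vars i (swap_vars ?j p) - (1 - b) * swap_vars i (swap_vars ?j (swap_vars i p))" for p
    using arg_cong[OF S21[of p], of "swap_vars i"]
    by (simp add: defs swap_vars_X transpose_def)
  have S212: "(a - b) * swap_vars ?j (swap_vars i (iso_div_diff ?j p)) =
      (1 - b) * swap_vars ?j (swap_vars i p) - (1 - a) * swap_vars ?j (swap_vars i (swap_vars ?j p))" for p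
    using arg_cong[OF S12[of p], of "swap_vars ?j"]
    by (simp add: defs swap_vars_X transpose_def)
  define F where "F = (1-c)*(1-c)*((1-b)*f - (1-a)*swap_vars i f)
    - (1-b)*(1-b)*((1-c)*swap_vars ?j f - (1-a)*swap_vars ?j (swap_vars i f))
    + (1-a)*(1-a)*((1-c)*swap_vars i (swap_vars ?j f)
        - (1-b)*swap_vars i (swap_vars ?j (swap_vars i f)))"
  have "(a - b) * (b - c) * (a - c) * iso_div_diff i (iso_div_diff ?j (iso_div_diff i f)) = F"
  proof -
    define g where "g = iso_div_diff i f"
    define h where "h = iso_div_diff ?j g"
    have "(a - b) * (b - c) * (a - c) * iso_div_diff i h =
        (b - c) * (a - c) * ((a - b) * iso_div_diff i h)" by (simp only: mult_ac)
    also have "\<dots> = (1-b) * (a-c) * ((b-c) * h) - (1-a) * (b-c) * ((a-c) * swap_vars i h)"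
      unfolding D1 by (simp only: algebra_simps)
    also have "\<dots> = (1-b) * (a-c) * ((1-c) * g - (1-b) * swap_vars ?j g)
        - (1-a) * (b-c) * ((1-c) * g - (1-a) * swap_vars i (swap_vars ?j g))"
      unfolding h_def D2 S12 by (simp add: g_def S11)
    also have "\<dots> = (1-c) * (1-c) * ((a-b) * g) - (1-b) * (1-b) * ((a-c) * swap_vars ?j g)
        + (1-a) * (1-a) * ((b-c) * swap_vars i (swap_vars ?j g))"
      by algebra
    also have "\<dots> = F"
      unfolding g_def D1 S21 S121 F_def ..
    finally show ?thesis by (simp add: g_def h_def)
  qed
  moreover have "(a - b) * (b - c) * (a - c) *
      iso_div_diff ?j (iso_div_diff i (iso_div_diff ?j f)) = F"
  proof -
    define g where "g = iso_div_diff ?j f"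
    define h where "h = iso_div_diff i g"
    have "(a - b) * (b - c) * (a - c) * iso_div_diff ?j h =
        (a - b) * (a - c) * ((b - c) * iso_div_diff ?j h)" by (simp only: mult_ac)
    also have "\<dots> = (1-c) * (a-c) * ((a-b) * h) - (1-b) * (a-b) * ((a-c) * swap_vars ?j h)"
      unfolding D2 by (simp only: algebra_simps)
    also have "\<dots> = (1-c) * (a-c) * ((1-b) * g - (1-a) * swap_vars i g)
        - (1-b) * (a-b) * ((1-c) * g - (1-a) * swap_vars ?j (swap_vars i g))"
      unfolding h_def D1 S21 by (simp add: g_def S22)
    also have "\<dots> = (1-c) * (1-b) * ((b-c) * g) - (1-c) * (1-a) * ((a-c) * swap_vars i g)
        + (1-b) * (1-a) * ((a-b) * swap_vars ?j (swap_vars i g))"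
      by algebra
    also have "\<dots> = F"
      unfolding g_def D2 S12 S212 F_def swap_vars_braid by algebra
    finally show ?thesis by (simp add: g_def h_def)
  qed
  ultimately have "(a - b) * (b - c) * (a - c) * iso_div_diff i (iso_div_diff ?j (iso_div_diff i f)) =
    (a - b) * (b - c) * (a - c) * iso_div_diff ?j (iso_div_diff i (iso_div_diff ?j f))" by simp
  then show ?thesis using nz by (metis mult_cancel_left no_zero_divisors)
qed

lemma finite_inversion_set: "finite (inversion_set n w)"
  by (rule finite_subset[of _ "{1..n} \<times> {1..n}"]) (auto simp: inversion_set_def)

lemma perm_length_le: "perm_length n w \<le> n * n"
proof -
  have "card (inversion_set n w) \<le> card ({1..n} \<times> {1..n})"
    by (rule card_mono) (auto simp: inversion_set_def)
  then show ?thesis by (simp add: perm_length_def)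
qed

lemma permutes_comp_transpose:
  assumes "w permutes {1..n}" "1 \<le> i" "i < n"
  shows "w \<circ> transpose i (Suc i) permutes {1..n}"
  using assms by (intro permutes_compose permutes_swap_id) auto

lemma perm_length_comp_transpose:
  assumes "1 \<le> i" "i < n" "w i < w (Suc i)"
  shows "perm_length n (w \<circ> transpose i (Suc i)) = Suc (perm_length n w)"
proof -
  let ?t = "transpose i (Suc i)"
  let ?T = "map_prod ?t ?t"
  have "inversion_set n (w \<circ> ?t) = insert (i, Suc i) (?T ` inversion_set n w)"
  proof (intro set_eqI iffI)
    fix z assume z: "z \<in> inversion_set n (w \<circ> ?t)"
    have "z = ?T (?T z)" by (cases z) simp
    moreover have "?T z \<in> inversion_set n w" if "z \<noteq> (i, Suc i)"
      using z that assms by (auto simp: inversion_set_def transpose_def split: if_splits)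
    ultimately show "z \<in> insert (i, Suc i) (?T ` inversion_set n w)" by blast
  next
    fix z assume z: "z \<in> insert (i, Suc i) (?T ` inversion_set n w)"
    show "z \<in> inversion_set n (w \<circ> ?t)"
    proof (cases "z = (i, Suc i)")
      case True then show ?thesis using assms by (simp add: inversion_set_def)
    next
      case False
      with z obtain x y where xy: "(x, y) \<in> inversion_set n w" "z = (?t x, ?t y)" by auto
      then have "(x, y) \<noteq> (i, Suc i)" using assms by (auto simp: inversion_set_def)
      then have "?t x < ?t y" "1 \<le> ?t x" "?t y \<le> n"
        using xy assms by (auto simp: inversion_set_def transpose_def)
      then show ?thesis using xy by (simp add: inversion_set_def)
    qed
  qed
  moreover have "(i, Suc i) \<notin> ?T ` inversion_set n w"
    by (auto simp: inversion_set_def transpose_def split: if_splits)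
  moreover have "inj_on ?T (inversion_set n w)"
    by (rule inj_on_subset[OF prod.inj_map[OF inj_transpose inj_transpose]]) simp
  ultimately show ?thesis
    by (simp add: perm_length_def card_image finite_inversion_set)
qed

lemma perm_length_less_iff:
  assumes "w permutes {1..n}" "1 \<le> i" "i < n"
  shows "perm_length n w < perm_length n (w \<circ> transpose i (Suc i)) \<longleftrightarrow> w i < w (Suc i)"
proof (cases "w i < w (Suc i)")
  case True
  then show ?thesis using perm_length_comp_transpose[of i n w] assms by simp
next
  case False
  have "w i \<noteq> w (Suc i)" using permutes_inj[OF assms(1)] by (simp add: inj_eq)
  with False have "w (Suc i) < w i" by simp
  then have "perm_length n w = Suc (perm_length n (w \<circ> transpose i (Suc i)))"
    using perm_length_comp_transpose[of i n "w \<circ> transpose i (Suc i)"] assms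
    by (simp add: comp_assoc)
  then show ?thesis using False by simp
qed

lemma longest_perm_permutes: "longest_perm n permutes {1..n}"
  by (rule bij_imp_permutes) (auto simp: longest_perm_def intro!: bij_betw_byWitness[of _ "longest_perm n"])

lemma ex_ascent:
  assumes w: "w permutes {1..n}" "w \<noteq> longest_perm n"
  shows "\<exists>i. 1 \<le> i \<and> i < n \<and> w i < w (Suc i)"
proof (rule ccontr)
  assume neg: "\<not> ?thesis"
  have dec: "w (Suc i) < w i" if "1 \<le> i" "i < n" for i
    using neg that permutes_inj[OF w(1)] by (metis inj_eq linorder_cases n_not_Suc_n)
  have range: "1 \<le> w i \<and> w i \<le> n" if "1 \<le> i" "i \<le> n" for i
    using permutes_in_image[OF w(1), of i] that by simp
  have up: "w (Suc k) + Suc k \<le> Suc n" if "Suc k \<le> n" for k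
    using that
  proof (induction k)
    case 0 then show ?case using range[of 1] by simp
  next
    case (Suc k) then show ?case using dec[of "Suc k"] by simp
  qed
  have low: "Suc k \<le> w (n - k)" if "k < n" for k
    using that
  proof (induction k)
    case 0 then show ?case using range[of n] by simp
  next
    case (Suc k)
    moreover have "Suc (n - Suc k) = n - k" using Suc.prems by simp
    moreover have "w (Suc (n - Suc k)) < w (n - Suc k)"
      using Suc.prems by (intro dec) simp_all
    ultimately show ?case by simp
  qed
  have "w i = longest_perm n i" for i
  proof (cases "i \<in> {1..n}")
    case True
    then have "w i + i \<le> Suc n" "Suc (n - i) \<le> w i" using up[of "i - 1"] low[of "n - i"] by simp_all
    then show ?thesis using True by (simp add: longest_perm_def)
  next
    case False
    then show ?thesis using permutes_not_in[OF w(1) False] by (auto simp: longest_perm_def)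
  qed
  then show False using w(2) by blast
qed

lemma is_grothendieck_ascentI:
  assumes "w permutes {1..n}" "1 \<le> i" "i < n" "w i < w (Suc i)"
    "is_grothendieck n (w \<circ> transpose i (Suc i)) f"
  shows "is_grothendieck n w (iso_div_diff i f)"
  using assms by (intro is_grothendieck.ascent) (simp_all add: perm_length_less_iff)

lemma is_grothendieck_ex1:
  assumes "w permutes {1..n}"
  shows "\<exists>!f. is_grothendieck n w f"
  using assms
proof (induction "n * n - perm_length n w" arbitrary: w rule: less_induct)
  case (less w)
  note w = \<open>w permutes {1..n}\<close>
  let ?t = "\<lambda>i::nat. transpose i (Suc i)"
  let ?G = "is_grothendieck n"
  have IH: "\<exists>!f. ?G v f" if "v permutes {1..n}" "perm_length n w < perm_length n v" for v
  proof -
    have "n * n - perm_length n v < n * n - perm_length n w"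
      using that(2) perm_length_le[of n v] by simp
    then show ?thesis using less.hyps that(1) by blast
  qed
  show ?case
  proof (cases "w = longest_perm n")
    case True
    have "f = (\<Prod>i=1..n. X i ^ (n - i))" if "?G w f" for f
      using that
    proof cases
      case (ascent i f')
      then have "w i < w (Suc i)" using perm_length_less_iff w by blast
      then show ?thesis using ascent True by (auto simp: longest_perm_def)
    qed simp
    then show ?thesis using is_grothendieck.longest True by blast
  next
    case False
    obtain i where i: "1 \<le> i" "i < n" "w i < w (Suc i)" using ex_ascent w False by blast
    have len: "perm_length n w < perm_length n (w \<circ> ?t i)" if "1 \<le> i" "i < n" "w i < w (Suc i)" for i
      using perm_length_less_iff that w by blast
    have ex: "\<exists>!f. ?G (w \<circ> ?t i) f" if "1 \<le> i" "i < n" "w i < w (Suc i)" for i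
      using IH len that permutes_comp_transpose w by blast
    have confl: "iso_div_diff i f = iso_div_diff j g"
      if "i < j" "1 \<le> i" "j < n" "w i < w (Suc i)" "w j < w (Suc j)"
        "?G (w \<circ> ?t i) f" "?G (w \<circ> ?t j) g" for i j f g
    proof -
      have i: "1 \<le> i" "i < n" "w i < w (Suc i)" and j: "1 \<le> j" "j < n" "w j < w (Suc j)"
        using that by auto
      have pi: "w \<circ> ?t i permutes {1..n}" and pj: "w \<circ> ?t j permutes {1..n}"
        using permutes_comp_transpose w i j by blast+
      show ?thesis
      proof (cases "j = Suc i")
        case False
        with that have far: "Suc i < j" by simp
        have comm: "w \<circ> ?t j \<circ> ?t i = w \<circ> ?t i \<circ> ?t j"
          using far by (auto simp: fun_eq_iff transpose_def)
        have asc: "(w \<circ> ?t i) j < (w \<circ> ?t i) (Suc j)" "(w \<circ> ?t j) i < (w \<circ> ?t j) (Suc i)"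
          using i j far by (simp_all add: transpose_def)
        have "perm_length n w < perm_length n (w \<circ> ?t i \<circ> ?t j)"
          using len[OF i] perm_length_comp_transpose[OF j(1,2) asc(1)] by linarith
        then obtain h where h: "?G (w \<circ> ?t i \<circ> ?t j) h"
          using IH permutes_comp_transpose[OF pi j(1,2)] by blast
        have "?G (w \<circ> ?t i) (iso_div_diff j h)"
          by (rule is_grothendieck_ascentI[OF pi j(1,2) asc(1) h])
        then have "f = iso_div_diff j h" using ex[OF i] that by blast
        moreover have "?G (w \<circ> ?t j) (iso_div_diff i h)"
          by (rule is_grothendieck_ascentI[OF pj i(1,2) asc(2)]) (simp only: comm h)
        then have "g = iso_div_diff i h" using ex[OF j] that by blast
        ultimately show ?thesis using iso_div_diff_commute[OF far] by simp
      next
        case j_eq: True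
        have braid: "w \<circ> ?t j \<circ> ?t i \<circ> ?t j = w \<circ> ?t i \<circ> ?t j \<circ> ?t i"
          using transpose_braid[of i] by (simp add: j_eq comp_assoc)
        have asc: "(w \<circ> ?t i) j < (w \<circ> ?t i) (Suc j)"
          "(w \<circ> ?t i \<circ> ?t j) i < (w \<circ> ?t i \<circ> ?t j) (Suc i)"
          "(w \<circ> ?t j) i < (w \<circ> ?t j) (Suc i)"
          "(w \<circ> ?t j \<circ> ?t i) j < (w \<circ> ?t j \<circ> ?t i) (Suc j)"
          using i j j_eq by (simp_all add: transpose_def)
        have pij: "w \<circ> ?t i \<circ> ?t j permutes {1..n}" "w \<circ> ?t j \<circ> ?t i permutes {1..n}"
          using permutes_comp_transpose pi pj i j by blast+
        have "perm_length n w < perm_length n (w \<circ> ?t i \<circ> ?t j \<circ> ?t i)"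
          using len[OF i] perm_length_comp_transpose[OF j(1,2) asc(1)]
            perm_length_comp_transpose[OF i(1,2) asc(2)] by linarith
        then obtain h where h: "?G (w \<circ> ?t i \<circ> ?t j \<circ> ?t i) h"
          using IH permutes_comp_transpose[OF pij(1) i(1,2)] by blast
        have "?G (w \<circ> ?t i) (iso_div_diff j (iso_div_diff i h))"
          by (intro is_grothendieck_ascentI[OF pi j(1,2) asc(1)]
              is_grothendieck_ascentI[OF pij(1) i(1,2) asc(2)] h)
        then have "f = iso_div_diff j (iso_div_diff i h)" using ex[OF i] that by blast
        moreover have "?G (w \<circ> ?t j) (iso_div_diff i (iso_div_diff j h))"
          by (intro is_grothendieck_ascentI[OF pj i(1,2) asc(3)]
              is_grothendieck_ascentI[OF pij(2) j(1,2) asc(4)]) (simp only: braid h)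
        then have "g = iso_div_diff i (iso_div_diff j h)" using ex[OF j] that by blast
        ultimately show ?thesis using iso_div_diff_braid[of i h] j_eq by simp
      qed
    qed
    obtain f where f: "?G (w \<circ> ?t i) f" using ex[OF i] by blast
    have "?G w (iso_div_diff i f)" using is_grothendieck_ascentI[OF w i f] .
    moreover have "g = iso_div_diff i f" if "?G w g" for g
      using that
    proof cases
      case longest
      then show ?thesis using False by simp
    next
      case (ascent j g')
      then have j: "1 \<le> j" "j < n" "w j < w (Suc j)" using perm_length_less_iff w by blast+
      consider "i < j" | "j < i" | "i = j" by linarith
      then show ?thesis
      proof cases
        case 1
        then show ?thesis using confl[OF 1 i(1) j(2) i(3) j(3) f] ascent by simp
      next
        case 2
        then show ?thesis using confl[OF 2 j(1) i(2) j(3) i(3) _ f] ascent by simp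
      next
        case 3
        then show ?thesis using ex[OF i] f ascent by blast
      qed
    qed
    ultimately show ?thesis by blast
  qed
qed

lemma is_grothendieck_grothendieck:
  assumes "w permutes {1..n}"
  shows "is_grothendieck n w (grothendieck n w)"
  unfolding grothendieck_def using is_grothendieck_ex1[OF assms] by (rule theI')

theorem grothendieck_longest_perm:
  "grothendieck n (longest_perm n) = (\<Prod>i=1..n. X i ^ (n - i))"
  using is_grothendieck_ex1[OF longest_perm_permutes] is_grothendieck.longest
    is_grothendieck_grothendieck[OF longest_perm_permutes] by blast

theorem grothendieck_ascent:
  assumes "w permutes {1..n}" "1 \<le> i" "i < n"
    "perm_length n w < perm_length n (w \<circ> transpose i (Suc i))"
  shows "grothendieck n w = iso_div_diff i (grothendieck n (w \<circ> transpose i (Suc i)))"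
  using is_grothendieck_ex1[OF assms(1)] is_grothendieck_grothendieck[OF assms(1)]
    is_grothendieck.ascent[OF assms is_grothendieck_grothendieck[OF permutes_comp_transpose[OF assms(1-3)]]]
  by blast

end

theory Submission
  imports Defs
begin

text \<open>
  The supports of \<open>G\<^sub>w\<close> and \<open>G\<^sub>\<pi>\<close>, for \<open>\<pi>\<close> the layered permutation of \<open>w\<close>, are compared with one
  explicit set. For a set \<open>A\<close> of rows write \<open>1\<^sub>A\<close> for the exponent vector of
  \<open>\<Prod>i\<in>A. x\<^sub>i\<close>. A descent of \<open>w\<close> is a position \<open>c + k\<close>, where \<open>c\<close> is the number of entries before
  some decreasing run and \<open>k\<close> is at least 1 and smaller than the length of that run. Let \<open>M\<close> be the set
  of all sums of vectors \<open>1\<^sub>A\<close>, one for each descent \<open>c + k\<close>, with \<open>A \<subseteq> {1..c + k}\<close> and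
  \<open>card A \<ge> k\<close>. This set depends on the run lengths alone, so it is the same for \<open>w\<close> and \<open>\<pi>\<close>, and
  it lies between the two supports.

  The support of \<open>G\<^sub>w\<close> is contained in \<open>M\<close>. For every permutation, each exponent of \<open>G\<^sub>w\<close> is a sum of
  vectors \<open>1\<^sub>A\<close>, one for each column \<open>D\<close> of the Rothe diagram, where \<open>A\<close> has at least as many elements
  as \<open>D\<close> and none below the last row of \<open>D\<close> (\<open>keys_grothendieck_subset\<close>). This is shown by going down
  from the longest permutation and always undoing the first ascent: then one column is a full initial
  interval, which supplies a factor \<open>x\<^sub>i\<close>, the other columns treat rows \<open>i\<close> and \<open>i + 1\<close> alike after
  the step, and a Leibniz rule for the isobaric divided difference of \<open>x\<^sub>i f\<close> treats one column at a
  time. If \<open>w\<close> is fireworks, the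
  column of a run head is empty, because nothing before it is larger, and the column of the entry
  after a descent \<open>c + k\<close> ends at \<open>c + k\<close> and contains the \<open>k\<close> preceding entries of the run
  (\<open>fireworks_column_sums\<close>).

  The set \<open>M\<close> is contained in the support of \<open>G\<^sub>\<pi>\<close>. By the formula of Fomin and Kirillov, \<open>G\<^sub>w\<close> is a
  coefficient of a product of factors \<open>1 + x\<^sub>i T\<^sub>j\<close> in the 0-Hecke algebra
  (\<open>grothendieck_eq_pipe_rows\<close>). The sign of a term is determined by its degree and the
  length of \<open>w\<close>, so nothing cancels, and an exponent is in the support as soon as some pipe dream with
  these row sums has 0-Hecke product \<open>w\<close> (\<open>keys_pipe_rows\<close>). Such a pipe dream is built block by block
  by threading one wire for each \<open>k\<close> through the wires already placed. The new wire carries a smaller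
  value than the others and moves one place to the right in the first \<open>k\<close> rows of the set \<open>A\<close> that
  belongs to \<open>k\<close> (\<open>wire_chain\<close>). This can fail only where the wire would stand between two older
  wires that are just being exchanged, and an extremal choice of the sets \<open>A\<close> with the given sum
  excludes this (\<open>block_sets_normal_form\<close>).
\<close>

section \<open>Exponent vectors and column sums\<close>

abbreviation adj :: "nat \<Rightarrow> nat \<Rightarrow> nat" where
  "adj j \<equiv> transpose j (Suc j)"

lemma lookup_monomial_times:
  fixes f :: int_mpoly
  shows "Poly_Mapping.lookup (Poly_Mapping.single d 1 * f) (d + e) = Poly_Mapping.lookup f e"
proof -
  have "Poly_Mapping.keys f \<subseteq> UNIV" by simp
  then show ?thesis
  proof (induction f rule: frag_induction)
    case (one x)
    then show ?case by (simp add: mult_single lookup_single)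
  qed (simp_all add: algebra_simps lookup_minus)
qed

lemma keys_monomial_times:
  fixes f :: int_mpoly
  shows "Poly_Mapping.keys (Poly_Mapping.single d 1 * f) = (+) d ` Poly_Mapping.keys f"
proof
  show "Poly_Mapping.keys (Poly_Mapping.single d 1 * f) \<subseteq> (+) d ` Poly_Mapping.keys f"
    using keys_mult[of "Poly_Mapping.single d (1::int)" f] by (auto split: if_splits)
  show "(+) d ` Poly_Mapping.keys f \<subseteq> Poly_Mapping.keys (Poly_Mapping.single d 1 * f)"
    by (auto simp: in_keys_iff lookup_monomial_times)
qed

definition ind_exp :: "nat set \<Rightarrow> (nat \<Rightarrow>\<^sub>0 nat)" where
  "ind_exp A = (\<Sum>i\<in>A. Poly_Mapping.single i 1)"

lemma lookup_ind_exp: "finite A \<Longrightarrow> Poly_Mapping.lookup (ind_exp A) i = of_bool (i \<in> A)"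
  by (simp add: ind_exp_def lookup_sum lookup_single when_def)

lemma ind_exp_insert: "finite A \<Longrightarrow> i \<notin> A \<Longrightarrow> ind_exp (insert i A) = Poly_Mapping.single i 1 + ind_exp A"
  by (simp add: ind_exp_def)

lemma map_key_ind_exp:
  assumes "finite A" "i \<in> A \<longleftrightarrow> Suc i \<in> A"
  shows "Poly_Mapping.map_key (adj i) (ind_exp A) = ind_exp A"
proof (rule poly_mapping_eqI)
  fix k
  show "Poly_Mapping.lookup (Poly_Mapping.map_key (adj i) (ind_exp A)) k = Poly_Mapping.lookup (ind_exp A) k"
    using assms by (subst map_key.rep_eq) (auto simp: lookup_ind_exp transpose_def)
qed

definition column_sums :: "'a set \<Rightarrow> ('a \<Rightarrow> nat set set) \<Rightarrow> (nat \<Rightarrow>\<^sub>0 nat) set" where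
  "column_sums J K = {\<Sum>j\<in>J. ind_exp (A j) | A. \<forall>j\<in>J. A j \<in> K j}"

lemma column_sums_insert:
  assumes "finite J" "a \<notin> J" "B \<in> K a" "e \<in> column_sums J K"
  shows "ind_exp B + e \<in> column_sums (insert a J) K"
proof -
  obtain A where A: "e = (\<Sum>j\<in>J. ind_exp (A j))" "\<forall>j\<in>J. A j \<in> K j"
    using assms(4) by (auto simp: column_sums_def)
  have "(\<Sum>j\<in>J. ind_exp ((A(a := B)) j)) = e"
    unfolding A(1) using assms(2) by (intro sum.cong) auto
  then have "(\<Sum>j\<in>insert a J. ind_exp ((A(a := B)) j)) = ind_exp B + e"
    using assms(1,2) by simp
  moreover have "\<forall>j\<in>insert a J. (A(a := B)) j \<in> K j" using A(2) assms(3) by auto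
  ultimately show ?thesis unfolding column_sums_def by (intro CollectI exI[of _ "A(a := B)"]) simp
qed

section \<open>Demazure-Lascoux operators on column sums\<close>

text \<open>The isobaric divided difference on multiples of \<open>x\<^sub>i\<close>. With this factor split off, every term of the
  Leibniz rule below keeps or adds a row of a column, whereas the analogous rule for
  \<open>iso_div_diff\<close> has a term in which a row disappears.\<close>

definition demazure_lascoux :: "nat \<Rightarrow> int_mpoly \<Rightarrow> int_mpoly" where
  "demazure_lascoux i f = iso_div_diff i (X i * f)"

lemma demazure_lascoux_eq:
  "(X i - X (Suc i)) * demazure_lascoux i f =
    (1 - X (Suc i)) * X i * f - (1 - X i) * X (Suc i) * swap_vars i f"
  unfolding demazure_lascoux_def iso_div_diff_eq by (simp add: swap_vars_X mult.assoc)

lemma demazure_lascoux_unique: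
  assumes "(X i - X (Suc i)) * g = (1 - X (Suc i)) * X i * f - (1 - X i) * X (Suc i) * swap_vars i f"
  shows "demazure_lascoux i f = g"
proof -
  have "(X i - X (Suc i)) * demazure_lascoux i f = (X i - X (Suc i)) * g"
    using assms demazure_lascoux_eq[of i f] by simp
  then show ?thesis by (simp add: X_eq_iff)
qed

lemma demazure_lascoux_1: "demazure_lascoux i 1 = 1"
  by (rule demazure_lascoux_unique) (simp add: algebra_simps)

lemma demazure_lascoux_diff:
  "demazure_lascoux i (f - g) = demazure_lascoux i f - demazure_lascoux i g"
  by (rule demazure_lascoux_unique)
    (unfold right_diff_distrib[of "X i - X (Suc i)"] demazure_lascoux_eq swap_vars_diff, algebra)

lemma demazure_lascoux_symmetric:
  assumes "swap_vars i s = s"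
  shows "demazure_lascoux i (s * f) = s * demazure_lascoux i f"
proof (rule demazure_lascoux_unique)
  have "(X i - X (Suc i)) * (s * demazure_lascoux i f) = s * ((X i - X (Suc i)) * demazure_lascoux i f)"
    by algebra
  then show "(X i - X (Suc i)) * (s * demazure_lascoux i f) =
      (1 - X (Suc i)) * X i * (s * f) - (1 - X i) * X (Suc i) * swap_vars i (s * f)"
    unfolding demazure_lascoux_eq swap_vars_mult assms by algebra
qed

text \<open>Two cases of a twisted Leibniz rule. In each of them the exponents on the right arise from those of
  \<open>f\<close> and of its image by adding row \<open>i\<close>, row \<open>i + 1\<close>, or both.\<close>

lemma demazure_lascoux_X:
  "demazure_lascoux i (X i * f) = (1 - X (Suc i)) * X i * f + X (Suc i) * demazure_lascoux i f"
proof (rule demazure_lascoux_unique)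
  have "(X i - X (Suc i)) * ((1 - X (Suc i)) * X i * f + X (Suc i) * demazure_lascoux i f) =
     (X i - X (Suc i)) * (1 - X (Suc i)) * X i * f + X (Suc i) * ((X i - X (Suc i)) * demazure_lascoux i f)"
    by algebra
  then show "(X i - X (Suc i)) * ((1 - X (Suc i)) * X i * f + X (Suc i) * demazure_lascoux i f) =
    (1 - X (Suc i)) * X i * (X i * f) - (1 - X i) * X (Suc i) * swap_vars i (X i * f)"
    unfolding demazure_lascoux_eq swap_vars_mult swap_vars_X transpose_apply_first by algebra
qed

lemma demazure_lascoux_X_Suc:
  "demazure_lascoux i (X (Suc i) * f) = X i * demazure_lascoux i f - (1 - X (Suc i)) * X i * f"
proof (rule demazure_lascoux_unique)
  have "(X i - X (Suc i)) * (X i * demazure_lascoux i f - (1 - X (Suc i)) * X i * f) =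
     X i * ((X i - X (Suc i)) * demazure_lascoux i f) - (X i - X (Suc i)) * (1 - X (Suc i)) * X i * f"
    by algebra
  then show "(X i - X (Suc i)) * (X i * demazure_lascoux i f - (1 - X (Suc i)) * X i * f) =
    (1 - X (Suc i)) * X i * (X (Suc i) * f) - (1 - X i) * X (Suc i) * swap_vars i (X (Suc i) * f)"
    unfolding demazure_lascoux_eq swap_vars_mult swap_vars_X transpose_apply_second by algebra
qed

text \<open>Closure of a family of row sets under what \<open>demazure_lascoux i\<close> does to one column: if
  exactly one of the rows \<open>i\<close> and \<open>i + 1\<close> is in \<open>A\<close>, then that row may stay, be replaced by the
  other one, or be joined by it.\<close>

definition absorbs :: "nat \<Rightarrow> nat set set \<Rightarrow> nat set set \<Rightarrow> bool" where
  "absorbs i K K' \<longleftrightarrow> (\<forall>A\<in>K. finite A \<and> A \<in> K' \<and> ((i \<in> A) \<noteq> (Suc i \<in> A) \<longrightarrow>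
     (let B = A - {i, Suc i} in {insert i B, insert (Suc i) B, insert i (insert (Suc i) B)} \<subseteq> K')))"

text \<open>Induction on the number of columns. A column that contains both rows \<open>i\<close> and \<open>i + 1\<close> or neither is a
  symmetric factor and can be taken out; any other column is handled by the Leibniz rule for
  \<open>x\<^sub>i\<close> or \<open>x\<^bsub>i + 1\<^esub>\<close>, each of whose terms is one of the possibilities in \<open>absorbs\<close>.\<close>

lemma keys_demazure_lascoux_monomial:
  assumes "finite J" "\<And>j. j \<in> J \<Longrightarrow> absorbs i (K j) (K' j)" "\<And>j. j \<in> J \<Longrightarrow> A j \<in> K j"
  shows "Poly_Mapping.keys (demazure_lascoux i (Poly_Mapping.single (\<Sum>j\<in>J. ind_exp (A j)) 1))
    \<subseteq> column_sums J K'"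
  using assms
proof (induction J rule: finite_induct)
  case empty
  then show ?case by (simp add: demazure_lascoux_1 column_sums_def)
next
  case (insert a J)
  let ?f = "Poly_Mapping.single (\<Sum>j\<in>J. ind_exp (A j)) 1 :: int_mpoly"
  let ?D = "demazure_lascoux i"
  define m :: "nat set \<Rightarrow> int_mpoly" where "m B = Poly_Mapping.single (ind_exp B) 1" for B
  have mono: "Poly_Mapping.single (\<Sum>j\<in>insert a J. ind_exp (A j)) 1 = m (A a) * ?f"
    using insert(1,2) by (simp add: m_def mult_single)
  have D: "Poly_Mapping.keys (?D ?f) \<subseteq> column_sums J K'" using insert by auto
  have "\<forall>j\<in>J. A j \<in> K' j" using insert by (auto simp: absorbs_def)
  then have f: "Poly_Mapping.keys ?f \<subseteq> column_sums J K'" by (auto simp: column_sums_def)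
  have step: "Poly_Mapping.keys (m B * g) \<subseteq> column_sums (insert a J) K'"
    if "B \<in> K' a" "Poly_Mapping.keys g \<subseteq> column_sums J K'" for B g
  proof -
    have "(+) (ind_exp B) ` Poly_Mapping.keys g \<subseteq> column_sums (insert a J) K'"
      using that(2) column_sums_insert[where K = K' and a = a, OF insert(1,2) that(1)] by blast
    then show ?thesis unfolding m_def keys_monomial_times .
  qed
  have A: "absorbs i (K a) (K' a)" "A a \<in> K a" using insert by auto
  then have fin: "finite (A a)" "A a \<in> K' a" by (auto simp: absorbs_def)
  have sym: "swap_vars i (m B) = m B" if "finite B" "i \<in> B \<longleftrightarrow> Suc i \<in> B" for B
    unfolding m_def using map_key_ind_exp[OF that] by simp
  show ?case
  proof (cases "i \<in> A a \<longleftrightarrow> Suc i \<in> A a")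
    case True
    then have "?D (m (A a) * ?f) = m (A a) * ?D ?f"
      using fin by (intro demazure_lascoux_symmetric sym) auto
    then show ?thesis unfolding mono using step[OF fin(2) D] by simp
  next
    case False
    define B where "B = A a - {i, Suc i}"
    have B: "insert i B \<in> K' a" "insert (Suc i) B \<in> K' a" "insert i (insert (Suc i) B) \<in> K' a"
      using A False unfolding absorbs_def B_def Let_def by blast+
    have finB: "finite B" "i \<notin> B" "Suc i \<notin> B" using fin by (auto simp: B_def)
    have m: "m (insert i B) = X i * m B" "m (insert (Suc i) B) = X (Suc i) * m B"
      "m (insert i (insert (Suc i) B)) = X i * X (Suc i) * m B"
      using finB by (simp_all add: m_def ind_exp_insert X_def mult_single add.assoc)
    have Dm: "?D (m B * ?f) = m B * ?D ?f"
      using finB by (intro demazure_lascoux_symmetric sym) auto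
    let ?S = "column_sums (insert a J) K'"
    note D1 = step[OF B(1) D] and D2 = step[OF B(2) D] and f1 = step[OF B(1) f] and f3 = step[OF B(3) f]
    have keys_add: "Poly_Mapping.keys (p + q) \<subseteq> ?S" and keys_diff: "Poly_Mapping.keys (p - q) \<subseteq> ?S"
      if "Poly_Mapping.keys p \<subseteq> ?S" "Poly_Mapping.keys q \<subseteq> ?S" for p q :: int_mpoly
      using that Poly_Mapping.keys_add[of p q] Poly_Mapping.keys_diff[of p q] by (meson Un_least order.trans)+
    show ?thesis
    proof (cases "i \<in> A a")
      case True
      then have "A a = insert i B" using False by (auto simp: B_def)
      then have mA: "m (A a) = X i * m B" using m by simp
      have "?D (m (A a) * ?f) =
        m (insert i B) * ?f - m (insert i (insert (Suc i) B)) * ?f + m (insert (Suc i) B) * ?D ?f"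
        using demazure_lascoux_X[of i "m B * ?f"] unfolding mA m Dm mult.assoc by algebra
      then show ?thesis unfolding mono using keys_add[OF keys_diff[OF f1 f3] D2] by simp
    next
      case i: False
      then have "A a = insert (Suc i) B" using False by (auto simp: B_def)
      then have mA: "m (A a) = X (Suc i) * m B" using m by simp
      have "?D (m (A a) * ?f) =
        m (insert i B) * ?D ?f - (m (insert i B) * ?f - m (insert i (insert (Suc i) B)) * ?f)"
        using demazure_lascoux_X_Suc[of i "m B * ?f"] unfolding mA m Dm mult.assoc by algebra
      then show ?thesis unfolding mono using keys_diff[OF D1 keys_diff[OF f1 f3]] by simp
    qed
  qed
qed

lemma keys_demazure_lascoux:
  assumes "finite J" "\<And>j. j \<in> J \<Longrightarrow> absorbs i (K j) (K' j)" "Poly_Mapping.keys f \<subseteq> column_sums J K"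
  shows "Poly_Mapping.keys (demazure_lascoux i f) \<subseteq> column_sums J K'"
  using assms(3)
proof (induction f rule: frag_induction)
  case zero
  show ?case using demazure_lascoux_diff[of i 0 0] by simp
next
  case (one e)
  then obtain A where "e = (\<Sum>j\<in>J. ind_exp (A j))" "\<forall>j\<in>J. A j \<in> K j" by (auto simp: column_sums_def)
  then show ?case
    using keys_demazure_lascoux_monomial[where K = K and K' = K' and A = A, OF assms(1,2)] by simp
next
  case (diff f g)
  then show ?case
    using keys_diff[of "demazure_lascoux i f" "demazure_lascoux i g"] unfolding demazure_lascoux_diff by blast
qed

text \<open>The column \<open>a\<close> is forced to be \<open>{1..i}\<close> and contributes a factor \<open>x\<^sub>i\<close> to all of \<open>f\<close>. What is left of it is
  symmetric in rows \<open>i\<close> and \<open>i + 1\<close>, and the factor \<open>x\<^sub>i\<close> turns the isobaric divided difference into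
  \<open>demazure_lascoux\<close>.\<close>

lemma iso_div_diff_column_sums:
  fixes K K' :: "'a \<Rightarrow> nat set set"
  assumes "finite J" "a \<in> J" "1 \<le> i" "K a = {{1..i}}" "K' a = {{1..i - 1}}"
    and "\<And>j. j \<in> J \<Longrightarrow> j \<noteq> a \<Longrightarrow> absorbs i (K j) (K' j)"
    and "Poly_Mapping.keys f \<subseteq> column_sums J K"
  shows "Poly_Mapping.keys (iso_div_diff i f) \<subseteq> column_sums J K'"
proof -
  \<comment> \<open>the columns after division by \<open>x\<^sub>i\<close>\<close>
  define L where "L = K(a := {{1..i - 1}})"
  have sum: "(\<Sum>j\<in>J. ind_exp (A j)) = Poly_Mapping.single i 1 + (\<Sum>j\<in>J. ind_exp ((A(a := {1..i - 1})) j))"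
    if "A a = {1..i}" for A :: "'a \<Rightarrow> nat set"
  proof -
    have "{1..i} = insert i {1..i - 1}" using assms(3) by auto
    then have "ind_exp (A a) = Poly_Mapping.single i 1 + ind_exp {1..i - 1}"
      using that assms(3) by (simp add: ind_exp_insert del: atLeastAtMost_insertL)
    moreover have "(\<Sum>j\<in>J - {a}. ind_exp ((A(a := {1..i - 1})) j)) = (\<Sum>j\<in>J - {a}. ind_exp (A j))"
      by (intro sum.cong) auto
    ultimately show ?thesis
      unfolding sum.remove[OF assms(1,2)] by (simp only: fun_upd_same add.assoc)
  qed
  have "\<exists>g. f = X i * g \<and> Poly_Mapping.keys g \<subseteq> column_sums J L"
    using assms(7)
  proof (induction f rule: frag_induction)
    case zero
    show ?case by (intro exI[of _ 0]) simp
  next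
    case (one e)
    then obtain A where A: "e = (\<Sum>j\<in>J. ind_exp (A j))" "\<forall>j\<in>J. A j \<in> K j" by (auto simp: column_sums_def)
    define e' where "e' = (\<Sum>j\<in>J. ind_exp ((A(a := {1..i - 1})) j))"
    have "e = Poly_Mapping.single i 1 + e'" unfolding A(1) e'_def using A(2) assms(2,4) by (intro sum) auto
    moreover have "\<forall>j\<in>J. (A(a := {1..i - 1})) j \<in> L j" using A(2) by (auto simp: L_def)
    then have "e' \<in> column_sums J L" unfolding column_sums_def e'_def by blast
    ultimately show ?case by (intro exI[of _ "Poly_Mapping.single e' 1"]) (simp add: X_def mult_single)
  next
    case (diff p q)
    then obtain p' q' where "p = X i * p'" "q = X i * q'" "Poly_Mapping.keys p' \<subseteq> column_sums J L"
      "Poly_Mapping.keys q' \<subseteq> column_sums J L" by blast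
    then show ?case using keys_diff[of p' q'] by (intro exI[of _ "p' - q'"]) (auto simp: algebra_simps)
  qed
  then obtain g where g: "f = X i * g" "Poly_Mapping.keys g \<subseteq> column_sums J L" by blast
  have "absorbs i (L j) (K' j)" if "j \<in> J" for j
    using that assms(3,5,6) by (cases "j = a") (auto simp: L_def absorbs_def)
  then show ?thesis
    using keys_demazure_lascoux[where K = L and K' = K', OF assms(1) _ g(2)]
    by (simp add: g(1) demazure_lascoux_def)
qed

section \<open>Rothe columns bound the support\<close>

text \<open>The Rothe diagram of \<open>w\<close> has a box in row \<open>r\<close> and column \<open>j\<close> if \<open>w r > j\<close> and the value \<open>j\<close>
  occurs to the right of position \<open>r\<close>. Saying that \<open>j\<close> is not among the first \<open>r\<close> values avoids the inverse of
  \<open>w\<close>.\<close>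

definition rothe_column :: "nat \<Rightarrow> (nat \<Rightarrow> nat) \<Rightarrow> nat \<Rightarrow> nat set" where
  "rothe_column n w j = {r \<in> {1..n}. j < w r \<and> j \<notin> w ` {1..r}}"

text \<open>The union is the initial interval that ends at the largest element of \<open>D\<close>; this form also covers
  the empty column, for which only the empty set qualifies.\<close>

definition column_sets :: "nat set \<Rightarrow> nat set set" where
  "column_sets D = {A. A \<subseteq> (\<Union>r\<in>D. {1..r}) \<and> card D \<le> card A}"

lemma finite_column_sets: "finite D \<Longrightarrow> A \<in> column_sets D \<Longrightarrow> finite A"
  by (auto simp: column_sets_def intro: finite_subset)

lemma column_sets_initial: "column_sets {1..m} = {{1..m}}"
proof -
  have "(\<Union>r\<in>{1..m}. {1..r}) = {1..m}" by fastforce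
  then have "A \<in> column_sets {1..m} \<longleftrightarrow> A = {1..m}" for A
    unfolding column_sets_def using card_seteq[of "{1..m}" A] by auto
  then show ?thesis by blast
qed

text \<open>The step from \<open>w s\<^sub>i\<close> down to \<open>w\<close> exchanges rows \<open>i\<close> and \<open>i + 1\<close> of a column. Since a box in row
  \<open>i + 1\<close> comes with one in row \<open>i\<close> before the step, the column never ends exactly at row \<open>i\<close>
  after it, so its bounding interval contains both rows or neither.\<close>

lemma absorbs_column_sets:
  assumes "finite D" "D' = adj i ` D" "Suc i \<in> D \<Longrightarrow> i \<in> D" "1 \<le> i"
  shows "absorbs i (column_sets D) (column_sets D')"
proof -
  define U V where "U = (\<Union>r\<in>D. {1..r})" and "V = (\<Union>r\<in>D'. {1..r})"
  have card: "card D' = card D" unfolding assms(2) by (intro card_image) auto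
  have UV: "U \<subseteq> V"
  proof
    fix x assume "x \<in> U"
    then obtain r where r: "r \<in> D" "1 \<le> x" "x \<le> r" by (auto simp: U_def)
    show "x \<in> V"
    proof (cases "r = Suc i")
      case True
      then have "i \<in> D" using r assms(3) by blast
      then have "Suc i \<in> D'" using assms(2) by (metis imageI transpose_apply_first)
      then show ?thesis using r True by (auto simp: V_def)
    next
      case False
      then have "r \<le> adj i r" by (auto simp: transpose_def)
      moreover have "adj i r \<in> D'" using assms(2) r by blast
      ultimately show ?thesis using r unfolding V_def by (intro UN_I[of "adj i r"]) auto
    qed
  qed
  \<comment> \<open>the new bounding interval does not separate rows \<open>i\<close> and \<open>i + 1\<close>\<close>
  have sat: "i \<in> V \<and> Suc i \<in> V" if "i \<in> V \<or> Suc i \<in> V"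
  proof -
    have "\<exists>r\<in>D'. i \<le> r" using that by (auto simp: V_def dest: Suc_leD)
    then obtain r where r: "r \<in> D'" "i \<le> r" by blast
    have "Suc i \<in> D'" if "i \<in> D'"
    proof -
      have "Suc i \<in> D" using that unfolding assms(2) by (auto simp: transpose_def split: if_splits)
      then have "i \<in> D" by (rule assms(3))
      then show ?thesis using assms(2) by (metis imageI transpose_apply_first)
    qed
    then obtain r where "r \<in> D'" "Suc i \<le> r" using r by (cases "r = i") auto
    then have "i \<in> {1..r}" "Suc i \<in> {1..r}" using assms(4) by auto
    then show ?thesis using \<open>r \<in> D'\<close> unfolding V_def by blast
  qed
  show ?thesis
    unfolding absorbs_def Let_def
  proof (intro ballI conjI impI)
    fix A assume A: "A \<in> column_sets D"
    then show fin: "finite A" using finite_column_sets assms(1) by blast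
    have AU: "A \<subseteq> V" "card D' \<le> card A" using A UV by (auto simp: column_sets_def card U_def)
    then show "A \<in> column_sets D'" by (auto simp: column_sets_def V_def)
    let ?B = "A - {i, Suc i}"
    assume ne: "(i \<in> A) \<noteq> (Suc i \<in> A)"
    then have V: "i \<in> V" "Suc i \<in> V" using sat AU by blast+
    have "card A = Suc (card ?B)"
    proof (cases "i \<in> A")
      case True
      then have "?B = A - {i}" using ne by auto
      then show ?thesis using card.remove[OF fin True] by simp
    next
      case False
      then have "Suc i \<in> A" "?B = A - {Suc i}" using ne by auto
      then show ?thesis using card.remove[OF fin] by simp
    qed
    then have "card A = card (insert i ?B)" "card A = card (insert (Suc i) ?B)"
      "card A \<le> card (insert i (insert (Suc i) ?B))" using fin by auto
    then show "{insert i ?B, insert (Suc i) ?B, insert i (insert (Suc i) ?B)} \<subseteq> column_sets D'"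
      using AU V unfolding column_sets_def V_def[symmetric] by auto
  qed
qed

text \<open>Descending induction on the length. The ascent \<open>i\<close> has to be the first one: then the values
  \<open>w 1, \<dots>, w (i - 1)\<close> are all larger than \<open>w i\<close>, and the column of \<open>w i\<close> shrinks from \<open>{1..i}\<close> to
  \<open>{1..i - 1}\<close>. For a later ascent that column may end far above row \<open>i - 1\<close> after the step, and the
  exponents in the rows between would have to cancel.\<close>

theorem keys_grothendieck_subset:
  assumes "w permutes {1..n}"
  shows "Poly_Mapping.keys (grothendieck n w) \<subseteq> column_sums {1..n} (\<lambda>j. column_sets (rothe_column n w j))"
  using assms
proof (induction "n * n - perm_length n w" arbitrary: w rule: less_induct)
  case less
  note w = \<open>w permutes {1..n}\<close>
  show ?case
  proof (cases "w = longest_perm n")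
    case True
    have "rothe_column n w j = {1..n - j}" if "j \<in> {1..n}" for j
      using that by (auto simp: True rothe_column_def longest_perm_def image_iff)
    then have "\<forall>j\<in>{1..n}. {1..n - j} \<in> column_sets (rothe_column n w j)"
      by (simp add: column_sets_initial[unfolded One_nat_def])
    moreover have X_pow: "X i ^ m = Poly_Mapping.single (Poly_Mapping.single i m) 1" for i m
      by (induction m) (simp_all add: X_def mult_single flip: single_add)
    have "(\<Prod>i\<in>I. X i ^ h i) = Poly_Mapping.single (\<Sum>i\<in>I. Poly_Mapping.single i (h i)) 1"
      if "finite I" for I h
      using that by (induction I rule: finite_induct) (simp_all add: mult_single X_pow)
    then have "Poly_Mapping.keys (grothendieck n w) = {\<Sum>i=1..n. Poly_Mapping.single i (n - i)}"
      by (simp add: True grothendieck_longest_perm)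
    moreover have "(\<Sum>i=1..n. Poly_Mapping.single i (n - i)) = (\<Sum>j=1..n. ind_exp {1..n - j})"
    proof (rule poly_mapping_eqI)
      fix k
      have "{1..n} \<inter> {j. 1 \<le> k \<and> k \<le> n - j} = (if 1 \<le> k \<and> k \<le> n then {1..n - k} else {})" by auto
      then have "(\<Sum>j=1..n. of_bool (1 \<le> k \<and> k \<le> n - j)) = (if 1 \<le> k \<and> k \<le> n then n - k else 0)"
        by (simp add: sum_of_bool_eq)
      then show "Poly_Mapping.lookup (\<Sum>i=1..n. Poly_Mapping.single i (n - i)) k =
        Poly_Mapping.lookup (\<Sum>j=1..n. ind_exp {1..n - j}) k"
        by (auto simp: lookup_sum lookup_ind_exp lookup_single when_def)
    qed
    ultimately show ?thesis unfolding column_sums_def by auto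
  next
    case False
    define i where "i = (LEAST i. 1 \<le> i \<and> i < n \<and> w i < w (Suc i))"
    have i: "1 \<le> i" "i < n" "w i < w (Suc i)"
      using LeastI_ex[OF ex_ascent[OF w False]] by (simp_all add: i_def)
    have desc: "w (Suc k) < w k" if "1 \<le> k" "k < i" for k
    proof -
      have "\<not> (1 \<le> k \<and> k < n \<and> w k < w (Suc k))" using that(2) unfolding i_def by (rule not_less_Least)
      moreover have "w k \<noteq> w (Suc k)" using permutes_inj[OF w] by (simp add: inj_eq)
      ultimately show ?thesis using that i by simp
    qed
    have above: "w i < w k" if "1 \<le> k" "k < i" for k
    proof -
      have "k \<le> i - 1" using that by simp
      then show ?thesis using that
      proof (induction rule: inc_induct)
        case base then show ?case using desc[of "i - 1"] i by simp
      next
        case (step m)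
        then have "Suc m < i" by simp
        then have "w i < w (Suc m)" using step by simp
        also have "\<dots> < w m" using desc[of m] step by simp
        finally show ?case .
      qed
    qed
    let ?u = "w \<circ> adj i"
    have len: "perm_length n w < perm_length n ?u" using perm_length_comp_transpose[OF i] by simp
    then have "n * n - perm_length n ?u < n * n - perm_length n w"
      using perm_length_le[of n ?u] by simp
    then have IH: "Poly_Mapping.keys (grothendieck n ?u) \<subseteq> column_sums {1..n} (\<lambda>j. column_sets (rothe_column n ?u j))"
      using less permutes_comp_transpose i by blast
    have inj: "w p = w q \<longleftrightarrow> p = q" for p q using permutes_inj[OF w] by (simp add: inj_eq)
    \<comment> \<open>the two permutations have the same first \<open>r\<close> values except for \<open>r = i\<close>\<close>
    have img: "?u ` {1..r} = (if r = i then insert (w (Suc i)) (w ` {1..i - 1}) else w ` {1..r})" for r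
    proof (cases "r = i")
      case True
      have "{1..i} = insert i {1..i - 1}" using i by auto
      moreover have "adj i ` {1..i - 1} = {1..i - 1}"
        by (intro image_cong[THEN trans, OF refl _ image_ident]) (auto simp: transpose_def)
      ultimately show ?thesis using True unfolding image_comp[symmetric] by simp
    next
      case False
      have "adj i ` {1..r} = {1..r}"
      proof (cases "r < i")
        case True
        then show ?thesis by (auto simp: transpose_def image_iff)
      next
        case False
        with \<open>r \<noteq> i\<close> i have "i \<in> {1..r}" "Suc i \<in> {1..r}" by auto
        then show ?thesis by simp
      qed
      then show ?thesis using False unfolding image_comp[symmetric] by simp
    qed
    have img': "w ` {1..i} = insert (w i) (w ` {1..i - 1})" "w ` {1..Suc i} = insert (w (Suc i)) (insert (w i) (w ` {1..i - 1}))"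
    proof -
      have "{1..i} = insert i {1..i - 1}" "{1..Suc i} = insert (Suc i) (insert i {1..i - 1})" using i by auto
      then show "w ` {1..i} = insert (w i) (w ` {1..i - 1})" "w ` {1..Suc i} = insert (w (Suc i)) (insert (w i) (w ` {1..i - 1}))"
        by simp_all
    qed
    have low: "w i \<notin> w ` {1..r}" if "r < i" for r using that by (auto simp: inj)
    have mem_w: "r \<in> rothe_column n w j \<longleftrightarrow> 1 \<le> r \<and> r \<le> n \<and> j < w r \<and> j \<notin> w ` {1..r}" for r j
      by (auto simp: rothe_column_def)
    have mem_u: "r \<in> rothe_column n ?u j \<longleftrightarrow> 1 \<le> r \<and> r \<le> n \<and> j < ?u r \<and> j \<notin> ?u ` {1..r}" for r j
      by (auto simp: rothe_column_def)
    have col_u: "rothe_column n ?u (w i) = {1..i}"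
    proof (intro set_eqI)
      fix r
      consider "r < i" | "r = i" | "i < r" by linarith
      then show "r \<in> rothe_column n ?u (w i) \<longleftrightarrow> r \<in> {1..i}"
      proof cases
        case 1
        then show ?thesis using above low i unfolding mem_u img by (auto simp: transpose_def)
      next
        case 2
        then show ?thesis using low[of "i - 1"] i unfolding mem_u img by (auto simp: inj)
      next
        case 3
        then have "w i \<in> w ` {1..r}" using i by auto
        then show ?thesis using 3 unfolding mem_u img by simp
      qed
    qed
    have col_w: "rothe_column n w (w i) = {1..i - 1}"
    proof (intro set_eqI)
      fix r
      show "r \<in> rothe_column n w (w i) \<longleftrightarrow> r \<in> {1..i - 1}"
      proof (cases "r < i")
        case True
        then show ?thesis using above low i unfolding mem_w by auto
      next
        case False
        then have "r = 0 \<or> w i \<in> w ` {1..r}" using i by auto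
        then show ?thesis using False unfolding mem_w by auto
      qed
    qed
    have other: "rothe_column n w j = adj i ` rothe_column n ?u j \<and>
        (Suc i \<in> rothe_column n ?u j \<longrightarrow> i \<in> rothe_column n ?u j)" if j: "j \<noteq> w i" for j
    proof
      have "r \<in> rothe_column n w j \<longleftrightarrow> adj i r \<in> rothe_column n ?u j" for r
      proof -
        consider "r = i" | "r = Suc i" | "r \<noteq> i" "r \<noteq> Suc i" by blast
        then show ?thesis
        proof cases
          case 1
          show ?thesis using i j unfolding 1 mem_w mem_u img transpose_apply_first img' by auto
        next
          case 2
          show ?thesis using i j unfolding 2 mem_w mem_u img transpose_apply_second img' by auto
        next
          case 3
          then show ?thesis unfolding mem_w mem_u img by (simp add: transpose_def)
        qed
      qed
      then have "rothe_column n w j = adj i -` rothe_column n ?u j" by blast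
      moreover have "\<dots> = adj i ` rothe_column n ?u j"
        by (metis bij_transpose bij_vimage_eq_inv_image inv_transpose_eq)
      ultimately show "rothe_column n w j = adj i ` rothe_column n ?u j" by simp
      show "Suc i \<in> rothe_column n ?u j \<longrightarrow> i \<in> rothe_column n ?u j"
        using i unfolding mem_u img img' by auto
    qed
    have "w i \<in> {1..n}" using permutes_in_image[OF w, of i] i by simp
    then have "Poly_Mapping.keys (iso_div_diff i (grothendieck n ?u)) \<subseteq>
        column_sums {1..n} (\<lambda>j. column_sets (rothe_column n w j))"
    proof (rule iso_div_diff_column_sums[where a = "w i" and J = "{1..n}"
          and K = "\<lambda>j. column_sets (rothe_column n ?u j)", OF finite_atLeastAtMost _ i(1) _ _ _ IH])
      show "column_sets (rothe_column n ?u (w i)) = {{1..i}}"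
        "column_sets (rothe_column n w (w i)) = {{1..i - 1}}"
        by (simp_all only: col_u col_w column_sets_initial)
      fix j assume "j \<in> {1..n}" "j \<noteq> w i"
      have "finite (rothe_column n ?u j)" by (simp add: rothe_column_def)
      then show "absorbs i (column_sets (rothe_column n ?u j)) (column_sets (rothe_column n w j))"
        using other[OF \<open>j \<noteq> w i\<close>] absorbs_column_sets[OF _ _ _ i(1)] by simp
    qed
    then show ?thesis using grothendieck_ascent[OF w i(1,2) len] by simp
  qed
qed

section \<open>Rothe columns of fireworks permutations\<close>

text \<open>The row sets allowed for the descent \<open>c + k\<close> of a block that starts after position \<open>c\<close>.\<close>

definition block_sets :: "nat \<Rightarrow> nat \<Rightarrow> nat set set" where
  "block_sets c k = {A. A \<subseteq> {1..c + k} \<and> k \<le> card A}"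

fun layered_sums :: "nat \<Rightarrow> nat list \<Rightarrow> (nat \<Rightarrow>\<^sub>0 nat) set" where
  "layered_sums c [] = {0}"
| "layered_sums c (b # bs) =
    {d + e | d e. d \<in> column_sums {1..<b} (block_sets c) \<and> e \<in> layered_sums (c + b) bs}"

text \<open>The entry at index \<open>k\<close> of a run \<open>r\<close> of a fireworks permutation. Everything before the run is smaller
  than its head, which empties the column of the head. For \<open>k > 0\<close> the boxes of the column lie strictly above
  the position of the entry, and the \<open>k\<close> preceding entries of the run all give boxes.\<close>

lemma rothe_column_run:
  assumes w: "w permutes {1..n}" and word: "one_line n w = pre @ r @ post"
    and r: "sorted_wrt (>) r" and pre: "\<forall>x\<in>set pre. x < hd r" and k: "k < length r"
    and A: "A \<in> column_sets (rothe_column n w (r ! k))"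
  shows "if k = 0 then A = {} else A \<in> block_sets (length pre) k"
proof -
  let ?c = "length pre" and ?D = "rothe_column n w (r ! k)"
  have len: "length pre + length r \<le> n" using arg_cong[OF word, of length] by (simp add: one_line_def del: upt_Suc)
  have nth: "w (Suc p) = (pre @ r @ post) ! p" if "p < n" for p
    using that unfolding word[symmetric] one_line_def by (simp del: upt_Suc)
  have wr: "w (Suc (?c + t)) = r ! t" if "t < length r" for t
    using nth[of "?c + t"] that len by (simp add: nth_append)
  have wpre: "w (Suc p) \<in> set pre" if "p < ?c" for p
    using nth[of p] that len by (simp add: nth_append)
  have D: "q \<le> ?c + k" if "q \<in> ?D" for q
  proof (rule ccontr)
    assume "\<not> q \<le> ?c + k"
    then have "Suc (?c + k) \<in> {1..q}" by simp
    then have "w (Suc (?c + k)) \<in> w ` {1..q}" by (rule imageI)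
    then show False using that wr[OF k] by (simp add: rothe_column_def)
  qed
  show ?thesis
  proof (cases "k = 0")
    case True
    have "q \<notin> ?D" for q
    proof
      assume q: "q \<in> ?D"
      then obtain p where p: "q = Suc p" "p < ?c" using D[OF q] True by (cases q) (auto simp: rothe_column_def)
      have "hd r = r ! k" using True k by (simp add: hd_conv_nth)
      then show False using q wpre[OF p(2)] pre p(1) by (auto simp: rothe_column_def)
    qed
    then show ?thesis using A True by (auto simp: column_sets_def)
  next
    case False
    have "{Suc ?c..?c + k} \<subseteq> ?D"
    proof
      fix q assume "q \<in> {Suc ?c..?c + k}"
      then obtain t where t: "q = Suc (?c + t)" "t < k"
        by (metis Suc_le_eq add_Suc atLeastAtMost_iff le_Suc_ex nat_add_left_cancel_less)
      have "r ! k < w q" using wr[of t] t k sorted_wrt_nth_less[OF r t(2) k] by simp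
      moreover have "r ! k \<notin> w ` {1..q}"
      proof
        assume "r ! k \<in> w ` {1..q}"
        then obtain p where "p \<le> q" "w p = w (Suc (?c + k))" using wr[OF k] by auto
        then show False using permutes_inj[OF w] t by (simp add: inj_eq)
      qed
      ultimately show "q \<in> ?D" using t k len by (simp add: rothe_column_def)
    qed
    moreover have "finite ?D" by (simp add: rothe_column_def)
    ultimately have "k \<le> card ?D" using card_mono[of ?D "{Suc ?c..?c + k}"] by simp
    moreover have "(\<Union>q\<in>?D. {1..q}) \<subseteq> {1..?c + k}" using D by fastforce
    ultimately show ?thesis using A False unfolding column_sets_def block_sets_def by auto
  qed
qed

text \<open>The columns of a fireworks permutation are in bijection with its entries, and the nonempty ones with
  its descents, which are listed run by run here.\<close>

lemma fireworks_column_sums: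
  assumes w: "w permutes {1..n}" and "fireworks n w"
  shows "column_sums {1..n} (\<lambda>j. column_sets (rothe_column n w j)) \<subseteq>
    layered_sums 0 (map length (desc_runs (one_line n w)))"
proof
  fix e assume "e \<in> column_sums {1..n} (\<lambda>j. column_sets (rothe_column n w j))"
  then obtain A where e: "e = (\<Sum>j\<in>{1..n}. ind_exp (A j))"
    and A: "\<And>j. j \<in> {1..n} \<Longrightarrow> A j \<in> column_sets (rothe_column n w j)"
    unfolding column_sums_def by blast
  let ?rs = "desc_runs (one_line n w)"
  have set: "set (one_line n w) = {1..n}"
    using permutes_image[OF w] by (simp add: one_line_def atLeastLessThanSuc_atLeastAtMost del: upt_Suc)
  have "distinct (one_line n w)"
    using permutes_inj[OF w] by (simp add: one_line_def distinct_map inj_on_subset[of w UNIV] del: upt_Suc)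
  then have e': "e = sum_list (map (\<lambda>x. ind_exp (A x)) (concat ?rs))"
    unfolding e concat_desc_runs using set by (simp add: sum_list_distinct_conv_sum_set)
  have "sum_list (map (\<lambda>x. ind_exp (A x)) (concat rs)) \<in> layered_sums (length (concat ps)) (map length rs)"
    if "?rs = ps @ rs" for ps rs
    using that
  proof (induction rs arbitrary: ps)
    case (Cons r rs)
    have IH: "sum_list (map (\<lambda>x. ind_exp (A x)) (concat rs)) \<in> layered_sums (length (concat ps) + length r) (map length rs)"
      using Cons.IH[of "ps @ [r]"] Cons.prems by simp
    have r: "r \<noteq> []" "sorted_wrt (>) r"
      using desc_runs_nonempty[of r "one_line n w"] desc_runs_decreasing[of r "one_line n w"] Cons.prems by auto
    have word: "one_line n w = concat ps @ r @ concat rs"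
      using concat_desc_runs[of "one_line n w"] unfolding Cons.prems by simp
    have "x < hd r" if "s \<in> set ps" "x \<in> set s" for x s
    proof -
      have "s \<in> set ?rs" using that Cons.prems by simp
      then have "sorted_wrt (>) s" by (rule desc_runs_decreasing)
      then have "x \<le> hd s" using that(2) by (cases s) auto
      also have "hd s < hd r"
        using assms(2) that(1) unfolding fireworks_def Cons.prems by (auto simp: sorted_wrt_append)
      finally show ?thesis .
    qed
    then have pre: "\<forall>x\<in>set (concat ps). x < hd r" by auto
    have step: "if k = 0 then A (r ! k) = {} else A (r ! k) \<in> block_sets (length (concat ps)) k" if "k < length r" for k
    proof (rule rothe_column_run[OF w word r(2) pre that])
      have "r ! k \<in> set (one_line n w)" unfolding word using that by simp
      then show "A (r ! k) \<in> column_sets (rothe_column n w (r ! k))" using A set by blast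
    qed
    have "sum_list (map (\<lambda>x. ind_exp (A x)) r) = (\<Sum>k\<in>{0..<length r}. ind_exp (A (r ! k)))"
      by (simp add: sum_list_sum_nth)
    also have "\<dots> = ind_exp (A (r ! 0)) + (\<Sum>k\<in>{1..<length r}. ind_exp (A (r ! k)))"
      using r(1) by (simp add: sum.atLeast_Suc_lessThan)
    also have "ind_exp (A (r ! 0)) = 0" using step[of 0] r(1) by (simp add: ind_exp_def)
    finally have "sum_list (map (\<lambda>x. ind_exp (A x)) r) = (\<Sum>k\<in>{1..<length r}. ind_exp (A (r ! k)))" by simp
    moreover have "\<forall>k\<in>{1..<length r}. A (r ! k) \<in> block_sets (length (concat ps)) k" using step by auto
    ultimately have "sum_list (map (\<lambda>x. ind_exp (A x)) r) \<in> column_sums {1..<length r} (block_sets (length (concat ps)))"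
      unfolding column_sums_def by (intro CollectI exI[of _ "\<lambda>k. A (r ! k)"] conjI)
    then show ?case using IH by auto
  qed simp
  from this[of "[]" ?rs] show "e \<in> layered_sums 0 (map length ?rs)" unfolding e' by simp
qed

section \<open>The pipe dream formula\<close>

text \<open>A function \<open>\<phi>\<close> from permutations to polynomials stands for the element \<open>\<Sum>w. \<phi> w T\<^sub>w\<close> of the 0-Hecke
  algebra with \<open>T\<^sub>j T\<^sub>j = - T\<^sub>j\<close>. In these coordinates \<open>hecke_act j\<close> is multiplication by \<open>T\<^sub>j\<close> on the
  right, so nested applications read from the inside to the outside give a product from left to
  right.\<close>

definition hecke_act :: "nat \<Rightarrow> ((nat \<Rightarrow> nat) \<Rightarrow> int_mpoly) \<Rightarrow> (nat \<Rightarrow> nat) \<Rightarrow> int_mpoly" where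
  "hecke_act j \<phi> w = (if w (Suc j) < w j then \<phi> (w \<circ> adj j) - \<phi> w else 0)"

text \<open>Right multiplication by \<open>1 + x T\<^sub>j\<close>.\<close>

definition hecke_factor ::
    "nat \<Rightarrow> int_mpoly \<Rightarrow> ((nat \<Rightarrow> nat) \<Rightarrow> int_mpoly) \<Rightarrow> (nat \<Rightarrow> nat) \<Rightarrow> int_mpoly" where
  "hecke_factor j x \<phi> w = \<phi> w + x * hecke_act j \<phi> w"

text \<open>Right multiplication by \<open>(1 + x T\<^bsub>n-1\<^esub>) \<cdots> (1 + x T\<^sub>i)\<close>; choosing \<open>T\<^sub>j\<close> or 1 in each factor is the choice of
  crosses in row \<open>i\<close> of a pipe dream.\<close>

definition pipe_row ::
    "nat \<Rightarrow> nat \<Rightarrow> int_mpoly \<Rightarrow> ((nat \<Rightarrow> nat) \<Rightarrow> int_mpoly) \<Rightarrow> (nat \<Rightarrow> nat) \<Rightarrow> int_mpoly" where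
  "pipe_row n i x \<phi> = fold (\<lambda>j. hecke_factor j x) (rev [i..<n]) \<phi>"

text \<open>The signed generating function of the pipe dreams with \<open>m\<close> rows, sorted by their 0-Hecke product; the
  initial function stands for the unit of the algebra.\<close>

definition pipe_rows :: "nat \<Rightarrow> nat \<Rightarrow> (nat \<Rightarrow> nat) \<Rightarrow> int_mpoly" where
  "pipe_rows n m = fold (\<lambda>i. pipe_row n i (X i)) [1..<Suc m] (\<lambda>w. if w = id then 1 else 0)"

lemma pipe_row_empty: "n \<le> i \<Longrightarrow> pipe_row n i x \<phi> = \<phi>"
  by (simp add: pipe_row_def)

lemma pipe_row_step: "i < n \<Longrightarrow> pipe_row n i x \<phi> = hecke_factor i x (pipe_row n (Suc i) x \<phi>)"
  by (simp add: pipe_row_def upt_conv_Cons)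

lemma pipe_rows_0: "pipe_rows n 0 = (\<lambda>w. if w = id then 1 else 0)"
  by (simp add: pipe_rows_def)

lemma pipe_rows_Suc: "pipe_rows n (Suc m) = pipe_row n (Suc m) (X (Suc m)) (pipe_rows n m)"
  by (simp add: pipe_rows_def)

lemma hecke_act_quadratic: "hecke_act j (hecke_act j \<phi>) w = - hecke_act j \<phi> w"
  by (simp add: hecke_act_def)

lemma adj_commute:
  assumes "Suc i < j"
  shows "w \<circ> adj j \<circ> adj i = w \<circ> adj i \<circ> adj j"
  using assms by (auto simp: fun_eq_iff transpose_def)

lemma hecke_act_commute:
  assumes "Suc i < j"
  shows "hecke_act i (hecke_act j \<phi>) w = hecke_act j (hecke_act i \<phi>) w"
proof -
  have "(w \<circ> adj i) j = w j" "(w \<circ> adj i) (Suc j) = w (Suc j)"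
    "(w \<circ> adj j) i = w i" "(w \<circ> adj j) (Suc i) = w (Suc i)"
    using assms by (simp_all add: transpose_def)
  then show ?thesis
    using adj_commute[OF assms, of w] by (simp add: hecke_act_def)
qed

lemma hecke_act_braid:
  "hecke_act i (hecke_act (Suc i) (hecke_act i \<phi>)) w =
   hecke_act (Suc i) (hecke_act i (hecke_act (Suc i) \<phi>)) w"
proof -
  have [simp]: "w \<circ> adj (Suc i) \<circ> adj i \<circ> adj (Suc i) = w \<circ> adj i \<circ> adj (Suc i) \<circ> adj i"
    using transpose_braid[of i] by (simp add: comp_assoc)
  have [simp]: "(w \<circ> adj i) i = w (Suc i)" "(w \<circ> adj i) (Suc i) = w i"
    "(w \<circ> adj i) (Suc (Suc i)) = w (Suc (Suc i))"
    "(w \<circ> adj (Suc i)) i = w i" "(w \<circ> adj (Suc i)) (Suc i) = w (Suc (Suc i))"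
    "(w \<circ> adj (Suc i)) (Suc (Suc i)) = w (Suc i)" for w :: "nat \<Rightarrow> nat"
    by (simp_all add: transpose_def)
  have [simp]: "w \<circ> adj i \<circ> adj i = w" "w \<circ> adj (Suc i) \<circ> adj (Suc i) = w" for w :: "nat \<Rightarrow> nat"
    by (simp_all add: comp_assoc)
  show ?thesis
    unfolding hecke_act_def by (simp del: comp_apply)
qed

lemma hecke_act_add: "hecke_act j (\<lambda>v. \<phi> v + \<psi> v) w = hecke_act j \<phi> w + hecke_act j \<psi> w"
  by (simp add: hecke_act_def)

lemma hecke_act_scale: "hecke_act j (\<lambda>v. c * \<phi> v) w = c * hecke_act j \<phi> w"
  by (simp add: hecke_act_def algebra_simps)

text \<open>Right multiplication by \<open>(1 - x) + (y - x) T\<^sub>j\<close>, which is \<open>1 - x\<close> times the quotient of \<open>1 + y T\<^sub>j\<close> by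
  \<open>1 + x T\<^sub>j\<close>. The multiple \<open>1 - x\<close> clears the denominator.\<close>

definition hecke_quot ::
    "nat \<Rightarrow> int_mpoly \<Rightarrow> int_mpoly \<Rightarrow> ((nat \<Rightarrow> nat) \<Rightarrow> int_mpoly) \<Rightarrow> (nat \<Rightarrow> nat) \<Rightarrow> int_mpoly" where
  "hecke_quot j x y \<phi> w = (1 - x) * \<phi> w + (y - x) * hecke_act j \<phi> w"

lemma hecke_act_factor:
  "hecke_act j (hecke_factor k x \<phi>) w = hecke_act j \<phi> w + x * hecke_act j (hecke_act k \<phi>) w"
  unfolding hecke_factor_def by (simp add: hecke_act_add hecke_act_scale)

lemma hecke_act_quot:
  "hecke_act j (hecke_quot k x y \<phi>) w =
    (1 - x) * hecke_act j \<phi> w + (y - x) * hecke_act j (hecke_act k \<phi>) w"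
  unfolding hecke_quot_def by (simp add: hecke_act_add hecke_act_scale)

lemma hecke_factor_scale: "hecke_factor j x (\<lambda>v. c * \<phi> v) w = c * hecke_factor j x \<phi> w"
  unfolding hecke_factor_def hecke_act_scale by (simp add: algebra_simps)

lemma hecke_factor_quot: "hecke_quot j x y (hecke_factor j x \<phi>) w = (1 - x) * hecke_factor j y \<phi> w"
  unfolding hecke_quot_def hecke_act_factor
  by (simp add: hecke_act_quadratic hecke_factor_def) algebra

text \<open>With \<open>h\<^sub>j(x) = 1 + x T\<^sub>j\<close> and \<open>y \<ominus> x = (y - x) / (1 - x)\<close> this is the Yang-Baxter equation
  \<open>h\<^sub>i(x) h\<^bsub>i+1\<^esub>(y) h\<^sub>i(y \<ominus> x) = h\<^bsub>i+1\<^esub>(y \<ominus> x) h\<^sub>i(y) h\<^bsub>i+1\<^esub>(x)\<close>, multiplied by \<open>1 - x\<close>. After expansion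
  it is the braid relation and \<open>T\<^sub>j T\<^sub>j = - T\<^sub>j\<close>.\<close>

lemma yang_baxter:
  "hecke_quot i x y (hecke_factor (Suc i) y (hecke_factor i x \<phi>)) w =
   hecke_factor (Suc i) x (hecke_factor i y (hecke_quot (Suc i) x y \<phi>)) w"
proof -
  let ?a = "\<lambda>j. hecke_act j"
  have act2: "hecke_act j (hecke_act k (hecke_factor l x \<phi>)) w =
      hecke_act j (hecke_act k \<phi>) w + x * hecke_act j (hecke_act k (hecke_act l \<phi>)) w" for j k l x \<phi> w
    unfolding hecke_act_factor[abs_def] by (simp add: hecke_act_add hecke_act_scale)
  have act2q: "hecke_act j (hecke_act k (hecke_quot l x y \<phi>)) w =
      (1 - x) * hecke_act j (hecke_act k \<phi>) w + (y - x) * hecke_act j (hecke_act k (hecke_act l \<phi>)) w"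
    for j k l x \<phi> w
    unfolding hecke_act_quot[abs_def] by (simp add: hecke_act_add hecke_act_scale)
  \<comment> \<open>both sides expanded into monomials in the generators\<close>
  have L: "hecke_quot i x y (hecke_factor (Suc i) y (hecke_factor i x \<phi>)) w =
     (1 - x) * (\<phi> w + x * ?a i \<phi> w + y * (?a (Suc i) \<phi> w + x * ?a (Suc i) (?a i \<phi>) w))
     + (y - x) * (?a i \<phi> w + x * ?a i (?a i \<phi>) w
        + y * (?a i (?a (Suc i) \<phi>) w + x * ?a i (?a (Suc i) (?a i \<phi>)) w))"
    unfolding hecke_quot_def hecke_act_factor act2
    unfolding hecke_factor_def[of _ _ _ w] hecke_act_factor ..
  have R: "hecke_factor (Suc i) x (hecke_factor i y (hecke_quot (Suc i) x y \<phi>)) w =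
     (1 - x) * \<phi> w + (y - x) * ?a (Suc i) \<phi> w
     + y * ((1 - x) * ?a i \<phi> w + (y - x) * ?a i (?a (Suc i) \<phi>) w)
     + x * ((1 - x) * ?a (Suc i) \<phi> w + (y - x) * ?a (Suc i) (?a (Suc i) \<phi>) w
        + y * ((1 - x) * ?a (Suc i) (?a i \<phi>) w + (y - x) * ?a (Suc i) (?a i (?a (Suc i) \<phi>)) w))"
    unfolding hecke_factor_def[of _ _ _ w] hecke_act_factor act2q hecke_act_quot
    unfolding hecke_quot_def ..
  show ?thesis
    unfolding L R hecke_act_quadratic hecke_act_braid[of i \<phi> w] by algebra
qed

lemma hecke_factor_act_commute:
  assumes "Suc i < j"
  shows "hecke_factor j x (hecke_act i \<phi>) = hecke_act i (hecke_factor j x \<phi>)"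
  unfolding fun_eq_iff hecke_act_factor hecke_factor_def[of j x "hecke_act i \<phi>"]
    hecke_act_commute[OF assms] by simp

lemma hecke_factor_commute:
  assumes "Suc i < j"
  shows "hecke_factor j x (hecke_factor i y \<phi>) = hecke_factor i y (hecke_factor j x \<phi>)"
  unfolding fun_eq_iff hecke_factor_def[of j x "hecke_factor i y \<phi>"]
    hecke_factor_def[of i y "hecke_factor j x \<phi>"] hecke_act_factor hecke_act_commute[OF assms]
  by (simp add: hecke_factor_def algebra_simps)

lemma pipe_row_factor_commute:
  assumes "Suc i < k"
  shows "pipe_row n k x (hecke_factor i y \<phi>) = hecke_factor i y (pipe_row n k x \<phi>)"
proof (cases "k \<le> n")
  case True
  then show ?thesis using assms
    by (induction rule: inc_induct)
      (simp_all add: pipe_row_empty pipe_row_step hecke_factor_commute[of i])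
qed (simp add: pipe_row_empty)

lemma pipe_row_act_commute:
  assumes "Suc i < k"
  shows "pipe_row n k x (hecke_act i \<phi>) = hecke_act i (pipe_row n k x \<phi>)"
proof (cases "k \<le> n")
  case True
  then show ?thesis using assms
    by (induction rule: inc_induct)
      (simp_all add: pipe_row_empty pipe_row_step hecke_factor_act_commute[of i])
qed (simp add: pipe_row_empty)

lemma pipe_row_scale: "pipe_row n k x (\<lambda>v. c * \<phi> v) = (\<lambda>v. c * pipe_row n k x \<phi> v)"
proof (cases "k \<le> n")
  case True
  then show ?thesis
    by (induction rule: inc_induct) (auto simp: pipe_row_empty pipe_row_step hecke_factor_scale)
qed (simp add: pipe_row_empty)

lemma hecke_factor_add:
  "hecke_factor j x (\<lambda>v. \<phi> v + \<psi> v) = (\<lambda>v. hecke_factor j x \<phi> v + hecke_factor j x \<psi> v)"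
  by (auto simp: hecke_factor_def hecke_act_add algebra_simps)

lemma pipe_row_add:
  "pipe_row n k x (\<lambda>v. \<phi> v + \<psi> v) = (\<lambda>v. pipe_row n k x \<phi> v + pipe_row n k x \<psi> v)"
proof (cases "k \<le> n")
  case True
  then show ?thesis
    by (induction rule: inc_induct) (simp_all add: pipe_row_empty pipe_row_step hecke_factor_add)
qed (simp add: pipe_row_empty)

text \<open>Exchanging the variables of two adjacent rows costs one quotient factor on the right. In the
  downward induction on \<open>i\<close> the two factors with letter \<open>i\<close> are moved past the letters that commute
  with them, and the Yang-Baxter equation passes the quotient from letter \<open>i\<close> to letter \<open>i + 1\<close>.\<close>

lemma pipe_row_exchange:
  assumes "1 \<le> i" "i < n"
  shows "hecke_quot i x y (pipe_row n (Suc i) y (pipe_row n i x \<phi>)) =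
    (\<lambda>w. (1 - x) * pipe_row n (Suc i) x (pipe_row n i y \<phi>) w)"
proof -
  have "i \<le> n - 1" using assms by simp
  then show ?thesis
  proof (induction rule: inc_induct)
    case base
    then show ?case using assms
      by (simp add: pipe_row_empty pipe_row_step hecke_factor_quot fun_eq_iff)
  next
    case (step i)
    let ?\<psi> = "pipe_row n (Suc (Suc i)) y (pipe_row n (Suc i) x \<phi>)"
    \<comment> \<open>pull the letters \<open>i\<close> and \<open>i + 1\<close> of the two rows to the right\<close>
    have two: "pipe_row n (Suc i) u (pipe_row n i v \<phi>) =
      hecke_factor (Suc i) u (hecke_factor i v (pipe_row n (Suc (Suc i)) u (pipe_row n (Suc i) v \<phi>)))" for u v
      using step by (simp add: pipe_row_step[of i] pipe_row_step[of "Suc i" n u] pipe_row_factor_commute)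
    have "hecke_quot i x y (pipe_row n (Suc i) y (pipe_row n i x \<phi>)) w =
       hecke_factor (Suc i) x (hecke_factor i y (hecke_quot (Suc i) x y ?\<psi>)) w" for w
      unfolding two by (rule yang_baxter)
    also have "\<dots> w = (1 - x) * pipe_row n (Suc i) x (pipe_row n i y \<phi>) w" for w
      unfolding step.IH two hecke_factor_scale[abs_def] by (rule refl)
    finally show ?case by blast
  qed
qed

lemma swap_hecke_factor:
  "swap_vars i (hecke_factor j x \<phi> w) = hecke_factor j (swap_vars i x) (\<lambda>v. swap_vars i (\<phi> v)) w"
  by (simp add: hecke_factor_def hecke_act_def)

lemma swap_pipe_row:
  "(\<lambda>w. swap_vars i (pipe_row n k x \<phi> w)) = pipe_row n k (swap_vars i x) (\<lambda>v. swap_vars i (\<phi> v))"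
proof (cases "k \<le> n")
  case True
  then show ?thesis
  proof (induction rule: inc_induct)
    case (step k)
    show ?case
      unfolding pipe_row_step[OF step(2)] swap_hecke_factor step(3) by (rule refl)
  qed (simp add: pipe_row_empty)
qed (simp add: pipe_row_empty)

lemma swap_pipe_rows:
  assumes "m < i"
  shows "(\<lambda>w. swap_vars i (pipe_rows n m w)) = pipe_rows n m"
  using assms
proof (induction m)
  case (Suc m)
  then show ?case
    by (simp add: pipe_rows_Suc swap_pipe_row swap_vars_X)
qed (auto simp: pipe_rows_0)

text \<open>The exchange of \<open>x\<^sub>i\<close> and \<open>x\<^bsub>i+1\<^esub>\<close> affects only rows \<open>i\<close> and \<open>i + 1\<close>. The rows above are invariant, and
  the letters of the rows below are at least \<open>i + 2\<close>, so the quotient factor commutes with them.\<close>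

lemma pipe_rows_quot:
  assumes "1 \<le> i" "i < n" "Suc i \<le> m"
  shows "hecke_quot i (X i) (X (Suc i)) (pipe_rows n m) =
    (\<lambda>w. (1 - X i) * swap_vars i (pipe_rows n m w))"
  using assms(3)
proof (induction rule: dec_induct)
  case base
  obtain k where k: "i = Suc k" using assms(1) by (cases i) auto
  have "(\<lambda>w. swap_vars i (pipe_rows n (Suc i) w)) =
      pipe_row n (Suc i) (X i) (pipe_row n i (X (Suc i)) (pipe_rows n k))"
    unfolding pipe_rows_Suc[of n i] pipe_rows_Suc[of n k, folded k] swap_pipe_row swap_vars_X
    using swap_pipe_rows[of k i n] k by simp
  then have "swap_vars i (pipe_rows n (Suc i) w) =
      pipe_row n (Suc i) (X i) (pipe_row n i (X (Suc i)) (pipe_rows n k)) w" for w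
    by metis
  moreover have "pipe_rows n (Suc i) = pipe_row n (Suc i) (X (Suc i)) (pipe_row n i (X i) (pipe_rows n k))"
    unfolding pipe_rows_Suc[of n i] pipe_rows_Suc[of n k, folded k] by simp
  ultimately show ?case using pipe_row_exchange[OF assms(1,2)] by simp
next
  case (step m)
  have X: "swap_vars i (X (Suc m)) = X (Suc m)"
    using step by (simp add: swap_vars_X)
  have comm: "hecke_quot i x y (pipe_row n (Suc m) z \<phi>) = pipe_row n (Suc m) z (hecke_quot i x y \<phi>)" for x y z \<phi>
    using pipe_row_act_commute[of i "Suc m" n z \<phi>] step(1)
    unfolding hecke_quot_def[abs_def] by (simp add: pipe_row_add pipe_row_scale)
  have "(\<lambda>w. swap_vars i (pipe_rows n (Suc m) w)) = pipe_row n (Suc m) (X (Suc m)) (\<lambda>w. swap_vars i (pipe_rows n m w))"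
    unfolding pipe_rows_Suc swap_pipe_row X ..
  then have "swap_vars i (pipe_rows n (Suc m) w) = pipe_row n (Suc m) (X (Suc m)) (\<lambda>w. swap_vars i (pipe_rows n m w)) w" for w
    by metis
  then show ?case unfolding pipe_rows_Suc comm step.IH by (simp add: pipe_row_scale pipe_rows_Suc)
qed

text \<open>Comparing the coefficients of \<open>T\<close> at \<open>w s\<^sub>i\<close> in the exchange relation gives the defining recursion
  of Grothendieck polynomials.\<close>

lemma pipe_rows_ascent:
  assumes "1 \<le> i" "i < n" "w i < w (Suc i)"
  shows "pipe_rows n n w = iso_div_diff i (pipe_rows n n (w \<circ> adj i))"
proof -
  let ?G = "pipe_rows n n"
  have "(1 - X i) * ?G (w \<circ> adj i) + (X (Suc i) - X i) * (?G w - ?G (w \<circ> adj i))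
      = (1 - X i) * swap_vars i (?G (w \<circ> adj i))"
    using fun_cong[OF pipe_rows_quot[OF assms(1,2), of n], of "w \<circ> adj i"] assms
    by (simp add: hecke_quot_def hecke_act_def comp_assoc)
  then have "(X i - X (Suc i)) * ?G w =
      (1 - X (Suc i)) * ?G (w \<circ> adj i) - (1 - X i) * swap_vars i (?G (w \<circ> adj i))"
    by algebra
  then show ?thesis
    unfolding iso_div_diff_def by (intro div_diff_unique[symmetric]) (simp add: swap_vars_X)
qed

lemma perm_length_descent:
  assumes "1 \<le> j" "j < n" "w (Suc j) < w j"
  shows "perm_length n w = Suc (perm_length n (w \<circ> adj j))"
  using perm_length_comp_transpose[of j n "w \<circ> adj j"] assms by (simp add: comp_assoc)

text \<open>Carries the computation of the coefficient at the longest permutation: as long as every letter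
  increases the length, the only contribution to the new longest element comes from the previous one.\<close>

definition top_coeff :: "nat \<Rightarrow> ((nat \<Rightarrow> nat) \<Rightarrow> int_mpoly) \<Rightarrow> (nat \<Rightarrow> nat) \<Rightarrow> int_mpoly \<Rightarrow> bool" where
  "top_coeff n \<phi> w p \<longleftrightarrow> \<phi> w = p \<and> (\<forall>v. perm_length n w < perm_length n v \<longrightarrow> \<phi> v = 0)"

lemma top_coeff_hecke_factor:
  assumes "top_coeff n \<phi> w p" "1 \<le> j" "j < n" "w j < w (Suc j)"
  shows "top_coeff n (hecke_factor j x \<phi>) (w \<circ> adj j) (p * x)"
proof -
  have len: "perm_length n (w \<circ> adj j) = Suc (perm_length n w)"
    by (rule perm_length_comp_transpose[OF assms(2-4)])
  have "hecke_factor j x \<phi> v = 0" if "Suc (perm_length n w) < perm_length n v" for v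
  proof -
    have "perm_length n v = Suc (perm_length n (v \<circ> adj j))" if "v (Suc j) < v j"
      using perm_length_descent assms(2,3) that by blast
    then show ?thesis using that assms(1) by (auto simp: hecke_factor_def hecke_act_def top_coeff_def)
  qed
  then show ?thesis
    using assms len by (simp add: top_coeff_def hecke_factor_def hecke_act_def comp_assoc)
qed

text \<open>The permutation of \<open>{1..n}\<close> reached by the letters of rows \<open>1, \<dots>, i - 1\<close> and the letters
  \<open>n - 1, \<dots>, j\<close> of row \<open>i\<close>: the first \<open>i - 1\<close> entries are already reversed, and the value
  \<open>n + 1 - i\<close> has travelled from position \<open>n\<close> to position \<open>j\<close>.\<close>

definition partial_reverse :: "nat \<Rightarrow> nat \<Rightarrow> nat \<Rightarrow> nat \<Rightarrow> nat" where
  "partial_reverse n i j k =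
    (if k < 1 \<or> n < k then k else if k < i then Suc n - k
     else if k < j then Suc k - i else if k = j then Suc n - i else k - i)"

lemma top_coeff_pipe_row:
  assumes "1 \<le> i" "i \<le> j" "j \<le> n" "top_coeff n \<phi> (partial_reverse n i n) p"
  shows "top_coeff n (pipe_row n j x \<phi>) (partial_reverse n i j) (p * x ^ (n - j))"
  using assms(3,2)
proof (induction rule: inc_induct)
  case base
  then show ?case using assms by (simp add: pipe_row_empty)
next
  case (step j)
  have "partial_reverse n i j = partial_reverse n i (Suc j) \<circ> adj j"
    using step assms by (auto simp: fun_eq_iff partial_reverse_def transpose_def)
  moreover have "partial_reverse n i (Suc j) j < partial_reverse n i (Suc j) (Suc j)"
    using step assms by (auto simp: partial_reverse_def)
  ultimately show ?case
    using top_coeff_hecke_factor[OF step.IH, of j x] step assms(1)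
    by (simp add: pipe_row_step mult.assoc Suc_diff_Suc flip: power_Suc2 del: comp_apply)
qed

lemma pipe_rows_longest_perm:
  "pipe_rows n n (longest_perm n) = (\<Prod>i=1..n. X i ^ (n - i))"
proof -
  have "top_coeff n (pipe_rows n m) (partial_reverse n (Suc m) n) (\<Prod>i=1..m. X i ^ (n - i))" if "m \<le> n" for m
    using that
  proof (induction m)
    case 0
    have "partial_reverse n 1 n = id" by (auto simp: partial_reverse_def fun_eq_iff)
    then show ?case by (auto simp: top_coeff_def pipe_rows_0)
  next
    case (Suc m)
    have "partial_reverse n (Suc m) (Suc m) = partial_reverse n (Suc (Suc m)) n"
      using Suc by (auto simp: partial_reverse_def fun_eq_iff)
    then show ?case
      using top_coeff_pipe_row[of "Suc m" "Suc m" n "pipe_rows n m"] Suc by (simp add: pipe_rows_Suc)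
  qed
  from this[of n] have "pipe_rows n n (partial_reverse n (Suc n) n) = (\<Prod>i=1..n. X i ^ (n - i))"
    by (simp add: top_coeff_def)
  moreover have "partial_reverse n (Suc n) n = longest_perm n"
    by (auto simp: partial_reverse_def longest_perm_def fun_eq_iff)
  ultimately show ?thesis by simp
qed

text \<open>The pipe dream formula of Fomin and Kirillov: both sides satisfy the same recursion along ascents and
  have the same value at the longest permutation.\<close>

theorem grothendieck_eq_pipe_rows:
  assumes "w permutes {1..n}"
  shows "grothendieck n w = pipe_rows n n w"
  using assms
proof (induction "n * n - perm_length n w" arbitrary: w rule: less_induct)
  case less
  show ?case
  proof (cases "w = longest_perm n")
    case True
    then show ?thesis by (simp add: grothendieck_longest_perm pipe_rows_longest_perm)
  next
    case False
    then obtain i where i: "1 \<le> i" "i < n" "w i < w (Suc i)" using ex_ascent less.prems by blast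
    have len: "perm_length n w < perm_length n (w \<circ> adj i)"
      using perm_length_comp_transpose[OF i] by simp
    have "n * n - perm_length n (w \<circ> adj i) < n * n - perm_length n w"
      using len perm_length_le[of n "w \<circ> adj i"] by simp
    then have "grothendieck n (w \<circ> adj i) = pipe_rows n n (w \<circ> adj i)"
      using less permutes_comp_transpose i by blast
    then show ?thesis
      using grothendieck_ascent[OF less.prems i(1,2) len] pipe_rows_ascent[OF i] by simp
  qed
qed

section \<open>Pipe dreams do not cancel\<close>

definition monomial_degree :: "(nat \<Rightarrow>\<^sub>0 nat) \<Rightarrow> nat" where
  "monomial_degree e = (\<Sum>i\<in>Poly_Mapping.keys e. Poly_Mapping.lookup e i)"

lemma monomial_degree_Suc: "monomial_degree (Poly_Mapping.single i 1 + e) = Suc (monomial_degree e)"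
proof -
  have deg: "monomial_degree d = (\<Sum>k\<in>insert i (Poly_Mapping.keys e). Poly_Mapping.lookup d k)"
    if "Poly_Mapping.keys d \<subseteq> insert i (Poly_Mapping.keys e)" for d
    unfolding monomial_degree_def using that by (intro sum.mono_neutral_left) (auto simp: in_keys_iff)
  have "Poly_Mapping.keys (Poly_Mapping.single i 1 + e) \<subseteq> insert i (Poly_Mapping.keys e)"
    by (auto simp: in_keys_iff lookup_add lookup_single when_def split: if_splits)
  then have "monomial_degree (Poly_Mapping.single i 1 + e) =
      (\<Sum>k\<in>insert i (Poly_Mapping.keys e). (if k = i then 1 else 0) + Poly_Mapping.lookup e k)"
    by (subst deg) (auto simp: lookup_add lookup_single when_def intro!: sum.cong)
  also have "\<dots> = Suc (monomial_degree e)"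
    by (subst sum.distrib, subst deg) auto
  finally show ?thesis .
qed

text \<open>The sign of a coefficient depends only on the degree of its monomial and the length of the
  permutation. This is what rules out cancellation in products of the factors \<open>1 + x\<^sub>i T\<^sub>j\<close>.\<close>

definition alternating :: "nat \<Rightarrow> ((nat \<Rightarrow> nat) \<Rightarrow> int_mpoly) \<Rightarrow> bool" where
  "alternating n \<phi> \<longleftrightarrow>
    (\<forall>w e. 0 \<le> (-1) ^ (monomial_degree e + perm_length n w) * Poly_Mapping.lookup (\<phi> w) e)"

lemma alternatingD:
  "alternating n \<phi> \<Longrightarrow> 0 \<le> (-1) ^ (monomial_degree e + perm_length n w) * Poly_Mapping.lookup (\<phi> w) e"
  by (simp add: alternating_def)

text \<open>The three summands come from \<open>\<phi> w\<close>, from \<open>x\<^sub>i \<phi> (w s\<^sub>j)\<close> and from \<open>- x\<^sub>i \<phi> w\<close>. Multiplying by \<open>x\<^sub>i\<close> raises the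
  degree by one, and this is compensated by the change of length in the second and by the minus sign in
  the third, so that after normalising the sign all three are nonnegative and a sum vanishes
  only if each of them does.\<close>

lemma lookup_hecke_factor:
  assumes "alternating n \<phi>" "1 \<le> j" "j < n"
  shows "\<exists>a b c. (-1) ^ (monomial_degree e + perm_length n w) * Poly_Mapping.lookup (hecke_factor j (X i) \<phi> w) e
     = a + b + c \<and> 0 \<le> a \<and> 0 \<le> b \<and> 0 \<le> c \<and> (a \<noteq> 0 \<longleftrightarrow> e \<in> Poly_Mapping.keys (\<phi> w)) \<and>
     (w (Suc j) < w j \<longrightarrow> (b \<noteq> 0 \<longleftrightarrow> e \<in> (+) (Poly_Mapping.single i 1) ` Poly_Mapping.keys (\<phi> (w \<circ> adj j)))
        \<and> (c \<noteq> 0 \<longleftrightarrow> e \<in> (+) (Poly_Mapping.single i 1) ` Poly_Mapping.keys (\<phi> w)))"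
proof -
  let ?s = "\<lambda>e w. (-1::int) ^ (monomial_degree e + perm_length n w)"
  let ?d = "Poly_Mapping.single i (1::nat)"
  let ?a = "?s e w * Poly_Mapping.lookup (\<phi> w) e"
  have a: "0 \<le> ?a" "?a \<noteq> 0 \<longleftrightarrow> e \<in> Poly_Mapping.keys (\<phi> w)"
    using alternatingD[OF assms(1)] by (auto simp: in_keys_iff)
  show ?thesis
  proof (cases "w (Suc j) < w j")
    case False
    then have "?s e w * Poly_Mapping.lookup (hecke_factor j (X i) \<phi> w) e = ?a + 0 + 0"
      by (simp add: hecke_factor_def hecke_act_def)
    then show ?thesis using a False by (intro exI[of _ ?a] exI[of _ 0]) auto
  next
    case True
    let ?b = "?s e w * Poly_Mapping.lookup (X i * \<phi> (w \<circ> adj j)) e"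
    let ?c = "- (?s e w * Poly_Mapping.lookup (X i * \<phi> w) e)"
    have k: "e \<in> Poly_Mapping.keys (X i * f) \<longleftrightarrow> e \<in> (+) ?d ` Poly_Mapping.keys f" for f
      by (simp add: X_def keys_monomial_times)
    have sgn: "0 \<le> ?b \<and> 0 \<le> ?c"
    proof (cases "\<exists>e'. e = ?d + e'")
      case ex: True
      then obtain e' where e: "e = ?d + e'" by blast
      have *: "Poly_Mapping.lookup (X i * f) e = Poly_Mapping.lookup f e'" for f
        by (simp add: e X_def lookup_monomial_times)
      have deg: "monomial_degree e = Suc (monomial_degree e')" unfolding e by (rule monomial_degree_Suc)
      have "?b = ?s e' (w \<circ> adj j) * Poly_Mapping.lookup (\<phi> (w \<circ> adj j)) e'"
        unfolding * deg using perm_length_descent[OF assms(2,3) True] by simp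
      moreover have "?c = ?s e' w * Poly_Mapping.lookup (\<phi> w) e'"
        unfolding * deg by simp
      ultimately show ?thesis using alternatingD[OF assms(1)] by simp
    next
      case False
      then have "Poly_Mapping.lookup (X i * f) e = 0" for f
        using k[of f] by (auto simp: in_keys_iff)
      then show ?thesis by simp
    qed
    have "?s e w * Poly_Mapping.lookup (hecke_factor j (X i) \<phi> w) e = ?a + ?b + ?c"
      using True by (simp add: hecke_factor_def hecke_act_def lookup_add lookup_minus right_diff_distrib distrib_left)
    moreover have "?b \<noteq> 0 \<longleftrightarrow> e \<in> (+) ?d ` Poly_Mapping.keys (\<phi> (w \<circ> adj j))"
      "?c \<noteq> 0 \<longleftrightarrow> e \<in> (+) ?d ` Poly_Mapping.keys (\<phi> w)"
      unfolding k[symmetric] by (auto simp: in_keys_iff)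
    ultimately show ?thesis using a sgn by (intro exI[of _ ?a] exI[of _ ?b] exI[of _ ?c]) blast
  qed
qed

lemma alternating_hecke_factor:
  assumes "alternating n \<phi>" "1 \<le> j" "j < n"
  shows "alternating n (hecke_factor j (X i) \<phi>)"
  unfolding alternating_def
proof (intro allI)
  fix w e
  show "0 \<le> (-1) ^ (monomial_degree e + perm_length n w) * Poly_Mapping.lookup (hecke_factor j (X i) \<phi> w) e"
    using lookup_hecke_factor[OF assms, of e w i] by auto
qed

text \<open>The 0-Hecke product of a permutation with one generator, up to sign.\<close>

definition demazure_step :: "nat \<Rightarrow> (nat \<Rightarrow> nat) \<Rightarrow> nat \<Rightarrow> nat" where
  "demazure_step j w = (if w j < w (Suc j) then w \<circ> adj j else w)"

lemma keys_hecke_factor_mono: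
  assumes "alternating n \<phi>" "1 \<le> j" "j < n" "e \<in> Poly_Mapping.keys (\<phi> w)"
  shows "e \<in> Poly_Mapping.keys (hecke_factor j (X i) \<phi> w)"
  using lookup_hecke_factor[OF assms(1-3), of e w i] assms(4) by (auto simp: in_keys_iff)

lemma keys_hecke_factor_step:
  assumes "alternating n \<phi>" "1 \<le> j" "j < n" "e \<in> Poly_Mapping.keys (\<phi> w)" "w j \<noteq> w (Suc j)"
  shows "Poly_Mapping.single i 1 + e \<in> Poly_Mapping.keys (hecke_factor j (X i) \<phi> (demazure_step j w))"
proof (cases "w j < w (Suc j)")
  case True
  then have w: "demazure_step j w = w \<circ> adj j" "w \<circ> adj j \<circ> adj j = w"
    by (simp_all add: demazure_step_def comp_assoc)
  show ?thesis
    using lookup_hecke_factor[OF assms(1-3), of "Poly_Mapping.single i 1 + e" "w \<circ> adj j" i] assms(4) True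
    unfolding w by (auto simp: in_keys_iff)
next
  case False
  then show ?thesis
    using lookup_hecke_factor[OF assms(1-3), of "Poly_Mapping.single i 1 + e" w i] assms(4,5)
    by (auto simp: in_keys_iff demazure_step_def)
qed

definition demazure_row :: "nat \<Rightarrow> nat \<Rightarrow> nat set \<Rightarrow> (nat \<Rightarrow> nat) \<Rightarrow> nat \<Rightarrow> nat" where
  "demazure_row n i T w = fold (\<lambda>j v. if j \<in> T then demazure_step j v else v) (rev [i..<n]) w"

lemma demazure_row_empty: "n \<le> i \<Longrightarrow> demazure_row n i T w = w"
  by (simp add: demazure_row_def)

lemma demazure_row_step:
  "i < n \<Longrightarrow> demazure_row n i T w =
    (if i \<in> T then demazure_step i (demazure_row n (Suc i) T w) else demazure_row n (Suc i) T w)"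
  by (simp add: demazure_row_def upt_conv_Cons)

lemma inj_demazure_step: "inj w \<Longrightarrow> inj (demazure_step j w)"
  by (simp add: demazure_step_def inj_compose)

lemma inj_demazure_row:
  assumes "inj w"
  shows "inj (demazure_row n i T w)"
proof (cases "i \<le> n")
  case True
  then show ?thesis using assms
    by (induction rule: inc_induct) (simp_all add: demazure_row_empty demazure_row_step inj_demazure_step)
qed (use assms in \<open>simp add: demazure_row_empty\<close>)

text \<open>A letter in \<open>T\<close> contributes a cross and hence a factor \<open>x\<^sub>i\<close>, any other letter leaves the exponent as it is;
  both choices are available because no factor loses exponents.\<close>

lemma keys_pipe_row:
  assumes "alternating n \<phi>" "1 \<le> k" "inj w" "e \<in> Poly_Mapping.keys (\<phi> w)"
  shows "alternating n (pipe_row n k (X i) \<phi>) \<and>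
    Poly_Mapping.single i (card (T \<inter> {k..<n})) + e \<in> Poly_Mapping.keys (pipe_row n k (X i) \<phi> (demazure_row n k T w))"
proof (cases "k \<le> n")
  case True
  then show ?thesis using assms(2)
  proof (induction rule: inc_induct)
    case base
    then show ?case using assms by (simp add: pipe_row_empty demazure_row_empty)
  next
    case (step k)
    let ?w = "demazure_row n (Suc k) T w" and ?\<psi> = "pipe_row n (Suc k) (X i) \<phi>"
    let ?e = "Poly_Mapping.single i (card (T \<inter> {Suc k..<n})) + e"
    have IH: "alternating n ?\<psi>" "?e \<in> Poly_Mapping.keys (?\<psi> ?w)" using step by auto
    have ne: "?w k \<noteq> ?w (Suc k)" using inj_demazure_row[OF assms(3)] by (simp add: inj_eq)
    have k: "1 \<le> k" "k < n" using step by auto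
    have "{k..<n} = insert k {Suc k..<n}" using k by auto
    then have "T \<inter> {k..<n} = (if k \<in> T then insert k (T \<inter> {Suc k..<n}) else T \<inter> {Suc k..<n})" by auto
    then have "Poly_Mapping.single i (card (T \<inter> {k..<n})) + e =
        (if k \<in> T then Poly_Mapping.single i 1 + ?e else ?e)"
      by (simp add: add.assoc[symmetric] flip: single_add)
    then show ?case
      unfolding pipe_row_step[OF k(2)] demazure_row_step[OF k(2)]
      using keys_hecke_factor_step[where \<phi> = ?\<psi> and w = ?w, OF IH(1) k IH(2) ne, of i]
        keys_hecke_factor_mono[where \<phi> = ?\<psi> and w = ?w, OF IH(1) k IH(2), of i]
        alternating_hecke_factor[OF IH(1) k, of i] by (auto simp only: split: if_splits)
  qed
qed (use assms in \<open>simp add: pipe_row_empty demazure_row_empty\<close>)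

text \<open>The sets \<open>T i\<close> form a pipe dream whose 0-Hecke products after each row are the permutations
  \<open>v i\<close>. Its exponent survives because nothing cancels.\<close>

lemma keys_pipe_rows:
  assumes "v 0 = id" "\<forall>i<m. v (Suc i) = demazure_row n (Suc i) (T (Suc i)) (v i)"
  shows "alternating n (pipe_rows n m) \<and> inj (v m) \<and>
    (\<Sum>i=1..m. Poly_Mapping.single i (card (T i \<inter> {i..<n}))) \<in> Poly_Mapping.keys (pipe_rows n m (v m))"
  using assms(2)
proof (induction m)
  case 0
  have "inversion_set n id = {}" by (auto simp: inversion_set_def)
  then have "perm_length n id = 0" by (simp add: perm_length_def)
  moreover have "monomial_degree 0 = 0" by (simp add: monomial_degree_def)
  ultimately show ?case using assms(1)
    by (auto simp: alternating_def pipe_rows_0 lookup_one when_def)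
next
  case (Suc m)
  then have IH: "alternating n (pipe_rows n m)" "inj (v m)"
    "(\<Sum>i=1..m. Poly_Mapping.single i (card (T i \<inter> {i..<n}))) \<in> Poly_Mapping.keys (pipe_rows n m (v m))"
    by auto
  show ?case
    using keys_pipe_row[where \<phi> = "pipe_rows n m" and w = "v m" and k = "Suc m" and i = "Suc m"
        and T = "T (Suc m)", OF IH(1) _ IH(2,3)]
      inj_demazure_row[OF IH(2)] Suc.prems
    by (simp add: pipe_rows_Suc add.commute)
qed

section \<open>Threading wires through pipe dreams\<close>

text \<open>One row of a pipe dream acting on a word: the letters in \<open>T\<close> are applied from the largest to the
  smallest, and each sorts a pair of neighbours into decreasing order. The first element of the list
  sits at position \<open>j\<close>, and \<open>j\<close> is also the letter that compares it with the next element; larger letters act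
  before it, hence on the tail.\<close>

fun list_row :: "nat set \<Rightarrow> nat \<Rightarrow> 'a::linorder list \<Rightarrow> 'a list" where
  "list_row T j [] = []"
| "list_row T j (x # xs) = (case list_row T (Suc j) xs of [] \<Rightarrow> [x]
     | y # ys \<Rightarrow> if j \<in> T \<and> x < y then y # x # ys else x # y # ys)"

lemma length_list_row [simp]: "length (list_row T j xs) = length xs"
proof (induction xs arbitrary: j)
  case (Cons x xs)
  have "length (list_row T j (x # xs)) = Suc (length (list_row T (Suc j) xs))"
    by (cases "list_row T (Suc j) xs") simp_all
  then show ?case by (simp only: Cons list.size)
qed simp

lemma set_list_row [simp]: "set (list_row T j xs) = set xs"
proof (induction xs arbitrary: j)
  case (Cons x xs)
  have "set (list_row T j (x # xs)) = insert x (set (list_row T (Suc j) xs))"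
    by (cases "list_row T (Suc j) xs") (simp_all add: insert_commute)
  then show ?case by (simp only: Cons list.set)
qed simp

lemma list_row_Nil_iff [simp]: "list_row T j xs = [] \<longleftrightarrow> xs = []"
  by (metis length_0_conv length_list_row)

lemma list_row_cong:
  assumes "\<And>p. j \<le> p \<Longrightarrow> Suc p < j + length xs \<Longrightarrow> p \<in> T \<longleftrightarrow> p \<in> T'"
  shows "list_row T j xs = list_row T' j xs"
  using assms
proof (induction xs arbitrary: j)
  case (Cons x xs)
  have IH: "list_row T (Suc j) xs = list_row T' (Suc j) xs"
    using Cons.prems by (intro Cons.IH) auto
  show ?case
  proof (cases "xs = []")
    case False
    then have "j \<in> T \<longleftrightarrow> j \<in> T'" using Cons.prems[of j] by (cases xs) auto
    then show ?thesis by (simp add: IH split: list.split)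
  qed simp
qed simp

lemma list_row_shift:
  assumes "\<And>p. j \<le> p \<Longrightarrow> Suc p \<in> T' \<longleftrightarrow> p \<in> T"
  shows "list_row T' (Suc j) xs = list_row T j xs"
  using assms
proof (induction xs arbitrary: j)
  case (Cons x xs)
  then have "list_row T' (Suc (Suc j)) xs = list_row T (Suc j) xs" by auto
  then show ?case using Cons.prems[of j] by (simp split: list.split)
qed simp

lemma list_row_append:
  assumes "xs \<noteq> []" "j + length xs - 1 \<notin> T"
  shows "list_row T j (xs @ ys) = list_row T j xs @ list_row T (j + length xs) ys"
  using assms
proof (induction xs arbitrary: j)
  case (Cons x xs)
  show ?case
  proof (cases "xs = []")
    case True
    then show ?thesis using Cons.prems by (auto split: list.split)
  next
    case False
    then have "list_row T (Suc j) (xs @ ys) = list_row T (Suc j) xs @ list_row T (Suc j + length xs) ys"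
      using Cons.prems by (intro Cons.IH) auto
    moreover obtain z zs where "list_row T (Suc j) xs = z # zs"
      using False by (metis list_row_Nil_iff neq_Nil_conv)
    ultimately show ?thesis by simp
  qed
qed simp

text \<open>A new wire, carrying a value \<open>x\<close> smaller than all of \<open>L\<close>, stands at position \<open>H\<close>, after \<open>h\<close> older
  wires. Older crossings to its left keep their letter, those to its right are shifted by one, and
  \<open>m\<close> tells whether the new wire moves by crossing its right neighbour. A wire that stays put must not
  separate two wires that are exchanged in this row, which would be letter \<open>H - 1\<close> of the old row. A
  letter \<open>H - 1\<close> of the new row is harmless for a wire that stays, because \<open>x\<close> is smaller than its left neighbour
  already.\<close>

lemma list_row_insert:
  assumes "\<forall>p<H. (p \<in> T' \<longleftrightarrow> p \<in> T) \<or> Suc p = H \<and> \<not> m"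
    and "\<forall>p\<ge>H. Suc p \<in> T' \<longleftrightarrow> p \<in> T"
    and "\<forall>y\<in>set L. x < y" and "H = j + h" and "h \<le> length L"
    and "m \<longrightarrow> H \<in> T' \<and> h < length L"
    and "\<not> m \<longrightarrow> h = length L \<or> H \<notin> T' \<and> (h = 0 \<or> H - 1 \<notin> T)"
  shows "list_row T' j (take h L @ x # drop h L) =
    (let h' = (if m then Suc h else h) in take h' (list_row T j L) @ x # drop h' (list_row T j L))"
  using assms(3-7)
proof (induction L arbitrary: h j)
  case Nil
  have "h = 0" using Nil.prems(3) by simp
  moreover have "\<not> m" using Nil.prems(4) by auto
  ultimately show ?case by simp
next
  case (Cons y L)
  show ?case
  proof (cases h)
    case 0
    then have "list_row T' (Suc j) (y # L) = list_row T j (y # L)"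
      using Cons.prems(2) assms(2) by (intro list_row_shift) auto
    moreover obtain z zs where z: "list_row T j (y # L) = z # zs"
      by (metis list_row_Nil_iff neq_Nil_conv)
    moreover have "z \<in> set (y # L)" using z set_list_row[of T j "y # L"] by (metis list.set_intros(1))
    then have "x < z" using Cons.prems(1) by blast
    ultimately have "list_row T' j (x # y # L) = (if j \<in> T' then z # x # zs else x # z # zs)"
      by (simp only: list_row.simps(2)[of T' j x] list.case simp_thms)
    moreover have "m \<longleftrightarrow> j \<in> T'" using Cons.prems(2,4,5) 0 by auto
    ultimately show ?thesis using 0 z by (simp del: list_row.simps)
  next
    case (Suc h0)
    let ?h = "if m then Suc h0 else h0" and ?R = "list_row T (Suc j) L"
    have IH: "list_row T' (Suc j) (take h0 L @ x # drop h0 L) = take ?h ?R @ x # drop ?h ?R"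
    proof (rule Cons.IH[unfolded Let_def])
      show "\<forall>y\<in>set L. x < y" "H = Suc j + h0" "h0 \<le> length L"
        using Cons.prems(1-3) Suc by simp_all
      show "m \<longrightarrow> H \<in> T' \<and> h0 < length L" using Cons.prems(4) Suc by simp
      show "\<not> m \<longrightarrow> h0 = length L \<or> H \<notin> T' \<and> (h0 = 0 \<or> H - 1 \<notin> T)"
        using Cons.prems(5) Suc by auto
    qed
    have xy: "\<not> y < x" using Cons.prems(1) by auto
    have row: "list_row T' j (take h (y # L) @ x # drop h (y # L)) =
      (case take ?h ?R @ x # drop ?h ?R of [] \<Rightarrow> [y]
       | r # rs \<Rightarrow> if j \<in> T' \<and> y < r then r # y # rs else y # r # rs)"
      using Suc IH by simp
    show ?thesis
    proof (cases ?h)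
      case 0
      then have "\<not> m" "h0 = 0" by (auto split: if_splits)
      then have "?R = [] \<or> j \<notin> T" using Cons.prems(2,5) Suc by auto
      then have "list_row T j (y # L) = y # ?R" by (auto split: list.split)
      then show ?thesis unfolding row Let_def using \<open>\<not> m\<close> \<open>h0 = 0\<close> Suc xy by simp
    next
      case h1: (Suc h1)
      have "?h \<le> length L" using Cons.prems(3,4) Suc by auto
      then have "L \<noteq> []" using h1 by auto
      then obtain z zs where z: "?R = z # zs" by (metis list_row_Nil_iff neq_Nil_conv)
      have "j \<in> T' \<longleftrightarrow> j \<in> T" using assms(1)[rule_format, of j] Cons.prems(2) Suc h1 by (auto split: if_splits)
      moreover have "(if m then Suc h else h) = Suc (Suc h1)" using h1 Suc by (simp split: if_splits)
      ultimately show ?thesis unfolding row h1 z Let_def by (simp add: z)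
    qed
  qed
qed

text \<open>The positions \<open>c + 1, \<dots>, c + k + 1\<close> of a block of size \<open>k + 1\<close>. The sets \<open>T i\<close> are the rows of a
  pipe dream on the letters \<open>c + 1, \<dots>, c + k\<close>, and \<open>L i\<close> is the word after row \<open>i\<close>. Wire number
  \<open>k\<close> starts in front of the older wires, moves right in the first \<open>k\<close> rows of \<open>A k\<close> and then is
  last; in any further row of \<open>A k\<close> it repeats its crossing with the neighbour on the left, without effect.

  The letters of row \<open>i\<close> may not be smaller than \<open>i\<close>. This follows from \<open>A k \<subseteq> {1..c + k}\<close> and \<open>k \<le> card (A k)\<close>:
  so few rows are left that the wire has moved sufficiently far before row \<open>i\<close>.

  The last conjunct is what keeps the induction going. A crossing in row \<open>i\<close>
  that came with wire \<open>l\<close> has at least the letter that it had when wire \<open>l\<close> was inserted, since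
  letters only get larger when more wires are added.\<close>

lemma wire_chain:
  fixes A :: "nat \<Rightarrow> nat set"
  assumes A: "\<And>k. 1 \<le> k \<Longrightarrow> k \<le> K \<Longrightarrow> A k \<subseteq> {1..c + k} \<and> k \<le> card (A k)"
    and normal: "\<And>l k i. 1 \<le> l \<Longrightarrow> l < k \<Longrightarrow> k \<le> K \<Longrightarrow> i \<in> A l \<Longrightarrow> i \<notin> A k \<Longrightarrow>
      card (A l) = l \<and> A k \<inter> {1..<i} \<subseteq> A l"
    and "k \<le> K" "K \<le> M"
  shows "\<exists>T L. L 0 = [M - k..<Suc M] \<and> (\<forall>i. L (Suc i) = list_row (T (Suc i)) (Suc c) (L i)) \<and>
    T 0 = {} \<and> (\<forall>i. T i \<subseteq> {max i (Suc c)..c + k}) \<and> (\<forall>N\<ge>c + k. L N = rev [M - k..<Suc M]) \<and>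
    (\<forall>i. card (T i) = card {l \<in> {1..k}. i \<in> A l}) \<and>
    (\<forall>i. \<forall>j\<in>T i. \<exists>l\<in>{1..k}. i \<in> A l \<and> min (Suc c + card (A l \<inter> {1..<i})) (c + l) \<le> j)"
  using assms(3)
proof (induction k)
  case 0
  show ?case
    by (rule exI[of _ "\<lambda>_. {}"], rule exI[of _ "\<lambda>_. [M]"]) auto
next
  case (Suc k)
  then obtain T L where L0: "L 0 = [M - k..<Suc M]"
    and LS: "\<And>i. L (Suc i) = list_row (T (Suc i)) (Suc c) (L i)"
    and T0: "T 0 = {}" and T: "\<And>i. T i \<subseteq> {max i (Suc c)..c + k}"
    and LN: "\<And>N. c + k \<le> N \<Longrightarrow> L N = rev [M - k..<Suc M]"
    and cT: "\<And>i. card (T i) = card {l \<in> {1..k}. i \<in> A l}"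
    and info: "\<And>i j. j \<in> T i \<Longrightarrow> \<exists>l\<in>{1..k}. i \<in> A l \<and> min (Suc c + card (A l \<inter> {1..<i})) (c + l) \<le> j"
    by (auto simp: Suc_le_eq)
  define q where "q = Suc k"
  \<comment> \<open>before row \<open>i\<close> the new wire is preceded by \<open>h i\<close> older wires and stands at position \<open>H i\<close>\<close>
  define h where "h i = min (card (A q \<inter> {1..<i})) q" for i
  define H where "H i = Suc c + h i" for i
  \<comment> \<open>the minimum selects the crossing on the left for a wire that is already last\<close>
  define T' where "T' i = {p \<in> T i. p < H i} \<union> Suc ` {p \<in> T i. H i \<le> p} \<union>
    (if i \<in> A q then {min (H i) (c + q)} else {})" for i
  define L' where "L' i = take (h (Suc i)) (L i) @ (M - q) # drop (h (Suc i)) (L i)" for i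
  have q: "1 \<le> q" "q \<le> K" "q \<le> M" using Suc.prems assms(4) by (auto simp: q_def)
  have Aq: "A q \<subseteq> {1..c + q}" "q \<le> card (A q)" using A[OF q(1,2)] by auto
  then have finA: "finite (A q)" using finite_subset by blast
  have finT: "finite (T i)" for i using T[of i] finite_subset by blast
  have upt_q: "[M - q..<Suc M] = (M - q) # [M - k..<Suc M]"
    using q by (auto simp: q_def upt_conv_Cons Suc_diff_Suc)
  have len: "length (L i) = q" for i by (induction i) (use q in \<open>auto simp: L0 LS q_def\<close>)
  have setL: "set (L i) = {M - k..<Suc M}" for i by (induction i) (auto simp: L0 LS)
  have hq: "h i \<le> q" for i by (simp add: h_def)
  have hS: "h (Suc i) = (if i \<in> A q \<and> h i < q then Suc (h i) else h i)" for i
  proof (cases "i \<in> A q")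
    case True
    then have "A q \<inter> {1..<Suc i} = insert i (A q \<inter> {1..<i})" using Aq by auto
    then show ?thesis using True by (auto simp: h_def)
  next
    case False
    then have "A q \<inter> {1..<Suc i} = A q \<inter> {1..<i}" using less_Suc_eq by auto
    then show ?thesis using False by (simp add: h_def)
  qed
  \<comment> \<open>A crossing with letter \<open>H i - 1\<close> comes from an older wire \<open>l\<close> with \<open>i \<in> A l - A q\<close>. Then \<open>A l\<close>
    contains the rows of \<open>A q\<close> before \<open>i\<close>, so wire \<open>l\<close> had already moved at least as far as the
    new wire and crosses further to the right.\<close>
  have straddle: "H i - 1 \<notin> T i" if "i \<notin> A q" "h i < q" "h i \<noteq> 0" for i
  proof
    assume "H i - 1 \<in> T i"
    then obtain l where l: "1 \<le> l" "l \<le> k" "i \<in> A l"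
      "min (Suc c + card (A l \<inter> {1..<i})) (c + l) \<le> H i - 1" using info by fastforce
    have n: "card (A l) = l" "A q \<inter> {1..<i} \<subseteq> A l" using normal[of l q i] l that(1) q by (auto simp: q_def)
    have "A l \<subseteq> {1..c + l}" using A[of l] l Suc.prems by simp
    then have fin: "finite (A l)" using finite_subset by blast
    have hi: "h i = card (A q \<inter> {1..<i})" using that(2) by (simp add: h_def)
    also have "\<dots> \<le> card (A l \<inter> {1..<i})" using n(2) fin by (intro card_mono) auto
    finally have 1: "h i \<le> card (A l \<inter> {1..<i})" .
    have "insert i (A l \<inter> {1..<i}) \<subseteq> A l" using l by auto
    then have "card (insert i (A l \<inter> {1..<i})) \<le> card (A l)" by (rule card_mono[OF fin])
    then have "Suc (card (A l \<inter> {1..<i})) \<le> l" using n(1) fin by simp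
    then show False using 1 l(4) that by (auto simp: H_def)
  qed
  have "L' 0 = [M - q..<Suc M]" by (simp add: L'_def h_def L0 upt_q del: upt_Suc)
  moreover have "L' (Suc i) = list_row (T' (Suc i)) (Suc c) (L' i)" for i
  proof -
    let ?i = "Suc i"
    let ?m = "?i \<in> A q \<and> h ?i < q"
    have "list_row (T' ?i) (Suc c) (take (h ?i) (L i) @ (M - q) # drop (h ?i) (L i)) =
      (let h' = (if ?m then Suc (h ?i) else h ?i)
       in take h' (list_row (T ?i) (Suc c) (L i)) @ (M - q) # drop h' (list_row (T ?i) (Suc c) (L i)))"
    proof (rule list_row_insert[where H = "H ?i"])
      show "\<forall>y\<in>set (L i). M - q < y" using q setL by (auto simp: q_def)
      show "H ?i = Suc c + h ?i" by (simp add: H_def)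
      show "h ?i \<le> length (L i)" by (simp add: len hq)
      show "\<forall>p<H ?i. (p \<in> T' ?i \<longleftrightarrow> p \<in> T ?i) \<or> Suc p = H ?i \<and> \<not> ?m"
      proof (cases "?i \<in> A q \<and> h ?i = q")
        case True
        then show ?thesis by (auto simp: T'_def H_def)
      next
        case False
        then show ?thesis using hq[of ?i] by (auto simp: T'_def H_def)
      qed
      show "\<forall>p\<ge>H ?i. Suc p \<in> T' ?i \<longleftrightarrow> p \<in> T ?i"
        by (intro allI impI) (auto simp: T'_def min_def split: if_splits)
      show "?m \<longrightarrow> H ?i \<in> T' ?i \<and> h ?i < length (L i)" by (auto simp: T'_def H_def len)
      show "\<not> ?m \<longrightarrow> h ?i = length (L i) \<or> H ?i \<notin> T' ?i \<and> (h ?i = 0 \<or> H ?i - 1 \<notin> T ?i)"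
        using straddle[of ?i] hq[of ?i] by (auto simp: T'_def len)
    qed
    then show ?thesis unfolding L'_def LS hS[of ?i] Let_def by simp
  qed
  moreover have "T' 0 = {}" using T0 Aq by (auto simp: T'_def)
  moreover have "T' i \<subseteq> {max i (Suc c)..c + q}" for i
  proof -
    have "i \<le> H i \<and> i \<le> c + q" if "i \<in> A q"
    proof -
      have "A q \<subseteq> (A q \<inter> {1..<i}) \<union> {i..c + q}" using Aq by auto
      then have "card (A q) \<le> card ((A q \<inter> {1..<i}) \<union> {i..c + q})" using finA by (intro card_mono) auto
      also have "\<dots> \<le> card (A q \<inter> {1..<i}) + (Suc (c + q) - i)"
        using card_Un_le[of "A q \<inter> {1..<i}" "{i..c + q}"] by simp
      finally have "q \<le> card (A q \<inter> {1..<i}) + (Suc (c + q) - i)" using Aq(2) by linarith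
      moreover have "i \<le> c + q" using Aq(1) that by auto
      ultimately show ?thesis unfolding H_def h_def min_def by auto
    qed
    moreover have "Suc c \<le> H i" "Suc c \<le> c + q" using q(1) by (simp_all add: H_def)
    moreover have "i \<le> p \<and> Suc c \<le> p \<and> Suc p \<le> c + q" if "p \<in> T i" for p
      using T[of i] that by (auto simp: q_def)
    ultimately show ?thesis unfolding T'_def by (auto simp: le_SucI Suc_le_eq less_imp_le)
  qed
  moreover have "L' N = rev [M - q..<Suc M]" if "c + q \<le> N" for N
  proof -
    have "A q \<inter> {1..<Suc N} = A q" using Aq that by auto
    then have "h (Suc N) = q" using Aq by (simp add: h_def)
    then show ?thesis using that len[of N] unfolding L'_def upt_q by (simp add: LN q_def del: upt_Suc)
  qed
  moreover have "card (T' i) = card {l \<in> {1..q}. i \<in> A l}" for i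
  proof -
    have "card ({p \<in> T i. p < H i} \<union> Suc ` {p \<in> T i. H i \<le> p}) =
        card {p \<in> T i. p < H i} + card (Suc ` {p \<in> T i. H i \<le> p})"
      using finT by (intro card_Un_disjoint) auto
    also have "\<dots> = card {p \<in> T i. p < H i} + card {p \<in> T i. H i \<le> p}" by (simp add: card_image)
    also have "\<dots> = card ({p \<in> T i. p < H i} \<union> {p \<in> T i. H i \<le> p})"
      using finT by (intro card_Un_disjoint[symmetric]) auto
    also have "{p \<in> T i. p < H i} \<union> {p \<in> T i. H i \<le> p} = T i" by auto
    finally have 1: "card ({p \<in> T i. p < H i} \<union> Suc ` {p \<in> T i. H i \<le> p}) = card (T i)" .
    have "min (H i) (c + q) \<notin> {p \<in> T i. p < H i} \<union> Suc ` {p \<in> T i. H i \<le> p}"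
      using T[of i] hq[of i] by (auto simp: min_def H_def q_def)
    then have "card (T' i) = card (T i) + (if i \<in> A q then 1 else 0)"
      using 1 finT by (simp add: T'_def)
    moreover have "{l \<in> {1..q}. i \<in> A l} = (if i \<in> A q then insert q {l \<in> {1..k}. i \<in> A l} else {l \<in> {1..k}. i \<in> A l})"
      by (auto simp: q_def le_Suc_eq)
    ultimately show ?thesis by (simp add: cT q_def)
  qed
  moreover have "\<exists>l\<in>{1..q}. i \<in> A l \<and> min (Suc c + card (A l \<inter> {1..<i})) (c + l) \<le> j" if "j \<in> T' i" for i j
  proof (cases "i \<in> A q \<and> j = min (H i) (c + q)")
    case True
    then show ?thesis using q by (intro bexI[of _ q]) (auto simp: H_def h_def)
  next
    case False
    then have "\<exists>p\<in>T i. p \<le> j" using that by (auto simp: T'_def split: if_splits intro: le_SucI)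
    then obtain p where "p \<in> T i" "p \<le> j" by blast
    then show ?thesis using info[of p i] by (fastforce simp: q_def)
  qed
  ultimately show ?case unfolding q_def[symmetric] by (intro exI[of _ T'] exI[of _ L']) blast
qed

section \<open>Pipe dreams of blocks\<close>

lemma sum_remove_two:
  assumes "finite J" "l \<in> J" "k \<in> J" "l \<noteq> k"
  shows "sum f J = f l + f k + sum f (J - {l, k})"
proof -
  have "sum f J = f l + sum f (J - {l})" using assms by (simp add: sum.remove)
  also have "sum f (J - {l}) = f k + sum f (J - {l} - {k})" using assms by (intro sum.remove) auto
  finally show ?thesis by (simp add: add.assoc insert_commute flip: Diff_insert)
qed

text \<open>Among all decompositions of \<open>e\<close> choose one that maximises the weight, the sum of \<open>k i\<close> over all \<open>i \<in> A k\<close>.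
  Moving a row from a column to a later one, or exchanging two rows so that the larger one ends up in the
  later column, increases the weight, so no such change leads to admissible columns any more.\<close>

lemma block_sets_normal_form:
  assumes "e \<in> column_sums {1..<b} (block_sets c)"
  obtains A where "e = (\<Sum>k\<in>{1..<b}. ind_exp (A k))" "\<And>k. k \<in> {1..<b} \<Longrightarrow> A k \<in> block_sets c k"
    "\<And>l k i. 1 \<le> l \<Longrightarrow> l < k \<Longrightarrow> k < b \<Longrightarrow> i \<in> A l \<Longrightarrow> i \<notin> A k \<Longrightarrow> card (A l) = l \<and> A k \<inter> {1..<i} \<subseteq> A l"
proof -
  define P where "P A \<longleftrightarrow> e = (\<Sum>k\<in>{1..<b}. ind_exp (A k)) \<and> (\<forall>k\<in>{1..<b}. A k \<in> block_sets c k)" for A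
  define weight where "weight A = (\<Sum>k\<in>{1..<b}. k * \<Sum>(A k))" for A :: "nat \<Rightarrow> nat set"
  obtain A0 where A0: "P A0" using assms unfolding column_sums_def P_def by blast
  have bound: "weight A \<le> (\<Sum>k\<in>{1..<b}. k * \<Sum>{1..c + k})" if "P A" for A
    unfolding weight_def
  proof (rule sum_mono)
    fix k assume "k \<in> {1..<b}"
    then have "A k \<subseteq> {1..c + k}" using that by (simp add: P_def block_sets_def)
    then have "\<Sum>(A k) \<le> \<Sum>{1..c + k}" by (intro sum_mono2) simp_all
    then show "k * \<Sum>(A k) \<le> k * \<Sum>{1..c + k}" by simp
  qed
  have "\<exists>A. P A \<and> (\<forall>B. P B \<longrightarrow> weight B \<le> weight A)"
    using A0 bound
    by (intro ex_has_greatest_nat[of P A0 weight "Suc (\<Sum>k\<in>{1..<b}. k * \<Sum>{1..c + k})"])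
      (simp_all add: less_Suc_eq_le)
  then obtain A where A: "P A" and max: "\<And>B. P B \<Longrightarrow> weight B \<le> weight A" by blast
  have mem: "A k \<subseteq> {1..c + k}" "k \<le> card (A k)" "finite (A k)" if "1 \<le> k" "k < b" for k
    using A that finite_subset[of "A k" "{1..c + k}"] by (auto simp: P_def block_sets_def)
  \<comment> \<open>replacing the columns \<open>l\<close> and \<open>k\<close> without changing the sum does not increase the weight\<close>
  have exchange: "l * \<Sum>B + k * \<Sum>C \<le> l * \<Sum>(A l) + k * \<Sum>(A k)"
    if "1 \<le> l" "l < k" "k < b" "B \<in> block_sets c l" "C \<in> block_sets c k"
      "ind_exp B + ind_exp C = ind_exp (A l) + ind_exp (A k)" for l k B C
  proof -
    let ?A = "A(l := B, k := C)"
    have J: "finite {1..<b}" "l \<in> {1..<b}" "k \<in> {1..<b}" "l \<noteq> k" using that by auto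
    have "(\<Sum>j\<in>{1..<b} - {l, k}. ind_exp (?A j)) = (\<Sum>j\<in>{1..<b} - {l, k}. ind_exp (A j))"
      by (intro sum.cong) auto
    then have "(\<Sum>j\<in>{1..<b}. ind_exp (?A j)) = (\<Sum>j\<in>{1..<b}. ind_exp (A j))"
      using that(6) J(4) unfolding sum_remove_two[OF J] by simp
    then have "P ?A" using A that(4,5) unfolding P_def by auto
    then have "weight ?A \<le> weight A" by (rule max)
    moreover have "(\<Sum>j\<in>{1..<b} - {l, k}. j * \<Sum>(?A j)) = (\<Sum>j\<in>{1..<b} - {l, k}. j * \<Sum>(A j))"
      by (intro sum.cong) auto
    ultimately show ?thesis using that unfolding weight_def sum_remove_two[OF J] by simp
  qed
  have "card (A l) = l \<and> A k \<inter> {1..<i} \<subseteq> A l"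
    if lk: "1 \<le> l" "l < k" "k < b" and i: "i \<in> A l" "i \<notin> A k" for l k i
  proof
    have l: "A l \<subseteq> {1..c + l}" "l \<le> card (A l)" "finite (A l)"
      and k: "A k \<subseteq> {1..c + k}" "k \<le> card (A k)" "finite (A k)" using mem[of l] mem[of k] lk by auto
    have i1: "1 \<le> i" "i \<le> c + l" using i l by auto
    define D where "D = A l - {i}"
    have D: "A l = insert i D" "i \<notin> D" "finite D" using i l by (auto simp: D_def)
    have move: "ind_exp D + ind_exp (insert i (A k)) = ind_exp (A l) + ind_exp (A k)"
      unfolding D(1) using D(2,3) i(2) k(3) by (simp add: ind_exp_insert add.left_commute add.assoc)
    show "card (A l) = l"
    proof (rule ccontr)
      assume "card (A l) \<noteq> l"
      then have "D \<in> block_sets c l" using l D by (auto simp: block_sets_def)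
      moreover have "insert i (A k) \<in> block_sets c k" using k i i1 lk by (auto simp: block_sets_def)
      ultimately have "l * \<Sum>D + k * \<Sum>(insert i (A k)) \<le> l * \<Sum>(A l) + k * \<Sum>(A k)"
        using exchange lk move by blast
      then have "k * i \<le> l * i" unfolding D(1) using D(2,3) i(2) k(3) by (simp add: distrib_left)
      then show False using lk i1 by simp
    qed
    show "A k \<inter> {1..<i} \<subseteq> A l"
    proof
      fix a assume "a \<in> A k \<inter> {1..<i}"
      then have a: "a \<in> A k" "1 \<le> a" "a < i" by auto
      show "a \<in> A l"
      proof (rule ccontr)
        assume na: "a \<notin> A l"
        define E where "E = A k - {a}"
        have E: "A k = insert a E" "a \<notin> E" "finite E" "i \<notin> E" using a k i by (auto simp: E_def)
        have aD: "a \<notin> D" using na by (simp add: D_def)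
        have "insert a D \<in> block_sets c l" using l D aD a i1 by (auto simp: block_sets_def)
        moreover have "insert i E \<in> block_sets c k" using k E i1 lk by (auto simp: block_sets_def)
        moreover have "ind_exp (insert a D) + ind_exp (insert i E) = ind_exp (A l) + ind_exp (A k)"
          unfolding D(1) E(1) using D E aD by (simp add: ind_exp_insert ac_simps)
        ultimately have "l * \<Sum>(insert a D) + k * \<Sum>(insert i E) \<le> l * \<Sum>(A l) + k * \<Sum>(A k)"
          using exchange lk by blast
        then have "l * a + k * i \<le> l * i + k * a"
          unfolding D(1) E(1) using D(2,3) E(2-4) aD by (simp add: distrib_left)
        \<comment> \<open>rearrangement: \<open>(k - l) (i - a) \<le> 0\<close> contradicts \<open>l < k\<close> and \<open>a < i\<close>\<close>
        moreover obtain x y where "k = l + x" "0 < x" "i = a + y" "0 < y"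
          using lk(2) a(3) by (metis less_imp_add_positive)
        ultimately show False by (simp add: algebra_simps)
      qed
    qed
  qed
  then show thesis using that A by (auto simp: P_def)
qed

text \<open>There is a pipe dream with row sums \<open>e\<close> on the letters \<open>c + 1, \<dots>, c + m - 1\<close> that turns the increasing word on
  positions \<open>c + 1, \<dots>, c + m\<close> into \<open>xs\<close>. Row 0 does not exist, hence \<open>T 0 = {}\<close>; from row
  \<open>c + m\<close> on no letter is available, so the word is final by then.\<close>

definition word_chain :: "nat \<Rightarrow> nat \<Rightarrow> nat list \<Rightarrow> (nat \<Rightarrow>\<^sub>0 nat) \<Rightarrow> bool" where
  "word_chain c m xs e \<longleftrightarrow> (\<exists>T L. L 0 = [Suc c..<Suc (c + m)] \<and>
     (\<forall>i. L (Suc i) = list_row (T (Suc i)) (Suc c) (L i)) \<and> T 0 = {} \<and>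
     (\<forall>i. T i \<subseteq> {max i (Suc c)..<c + m}) \<and> (\<forall>N\<ge>c + m. L N = xs) \<and>
     (\<forall>i. Poly_Mapping.lookup e i = card (T i)))"

lemma word_chain_block:
  assumes "1 \<le> b" "e \<in> column_sums {1..<b} (block_sets c)"
  shows "word_chain c b (rev [Suc c..<Suc (c + b)]) e"
proof -
  obtain A where e: "e = (\<Sum>k\<in>{1..<b}. ind_exp (A k))" and A: "\<And>k. k \<in> {1..<b} \<Longrightarrow> A k \<in> block_sets c k"
    and normal: "\<And>l k i. 1 \<le> l \<Longrightarrow> l < k \<Longrightarrow> k < b \<Longrightarrow> i \<in> A l \<Longrightarrow> i \<notin> A k \<Longrightarrow>
      card (A l) = l \<and> A k \<inter> {1..<i} \<subseteq> A l"
    using block_sets_normal_form[OF assms(2)] by metis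
  have M: "c + b - (b - 1) = Suc c" using assms(1) by simp
  have b: "{1..b - 1} = {1..<b}" using assms(1) by auto
  have "\<exists>T L. L 0 = [c + b - (b - 1)..<Suc (c + b)] \<and> (\<forall>i. L (Suc i) = list_row (T (Suc i)) (Suc c) (L i)) \<and>
    T 0 = {} \<and> (\<forall>i. T i \<subseteq> {max i (Suc c)..c + (b - 1)}) \<and>
    (\<forall>N\<ge>c + (b - 1). L N = rev [c + b - (b - 1)..<Suc (c + b)]) \<and>
    (\<forall>i. card (T i) = card {l \<in> {1..b - 1}. i \<in> A l}) \<and>
    (\<forall>i. \<forall>j\<in>T i. \<exists>l\<in>{1..b - 1}. i \<in> A l \<and> min (Suc c + card (A l \<inter> {1..<i})) (c + l) \<le> j)"
  proof (rule wire_chain[where K = "b - 1"])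
    fix k assume "1 \<le> k" "k \<le> b - 1"
    then show "A k \<subseteq> {1..c + k} \<and> k \<le> card (A k)" using A[of k] by (auto simp: block_sets_def)
  next
    fix l k i assume "1 \<le> l" "l < k" "k \<le> b - 1" "i \<in> A l" "i \<notin> A k"
    then show "card (A l) = l \<and> A k \<inter> {1..<i} \<subseteq> A l" using normal[of l k i] by simp
  qed simp_all
  then obtain T L where TL: "L 0 = [Suc c..<Suc (c + b)]" "\<forall>i. L (Suc i) = list_row (T (Suc i)) (Suc c) (L i)"
    "T 0 = {}" "\<forall>i. T i \<subseteq> {max i (Suc c)..c + (b - 1)}" "\<forall>N\<ge>c + (b - 1). L N = rev [Suc c..<Suc (c + b)]"
    "\<forall>i. card (T i) = card {l \<in> {1..<b}. i \<in> A l}"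
    unfolding M b by blast
  have "Poly_Mapping.lookup e i = card (T i)" for i
  proof -
    have "finite (A k)" if "k \<in> {1..<b}" for k
      using A[OF that] finite_subset[of "A k" "{1..c + k}"] by (auto simp: block_sets_def)
    then have "Poly_Mapping.lookup e i = (\<Sum>k\<in>{1..<b}. of_bool (i \<in> A k))"
      unfolding e lookup_sum by (intro sum.cong) (auto simp: lookup_ind_exp)
    also have "\<dots> = card {l \<in> {1..<b}. i \<in> A l}" by (simp add: sum_of_bool_eq Int_def)
    finally show ?thesis using TL(6) by simp
  qed
  moreover have "T i \<subseteq> {max i (Suc c)..<c + b}" for i using TL(4) assms(1) by (fastforce simp: subset_iff)
  ultimately show ?thesis unfolding word_chain_def using TL(1-3,5)
    by (intro exI[of _ T] exI[of _ L]) auto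
qed

lemma word_chain_length:
  assumes "word_chain c m xs e"
  shows "length xs = m"
proof -
  obtain T L where L: "L 0 = [Suc c..<Suc (c + m)]" "\<forall>i. L (Suc i) = list_row (T (Suc i)) (Suc c) (L i)"
    "\<forall>N\<ge>c + m. L N = xs" using assms unfolding word_chain_def by blast
  have "length (L i) = m" for i by (induction i) (simp_all add: L(1,2) del: upt_Suc)
  then show ?thesis using L(3) by (metis order.refl)
qed

text \<open>Blocks can be treated side by side: the letter \<open>c + m\<close>, which would connect the two parts, is absent.\<close>

lemma word_chain_append:
  assumes "word_chain c m xs d" "word_chain (c + m) m' ys e" "0 < m"
  shows "word_chain c (m + m') (xs @ ys) (d + e)"
proof -
  obtain T L where L: "L 0 = [Suc c..<Suc (c + m)]" "\<forall>i. L (Suc i) = list_row (T (Suc i)) (Suc c) (L i)"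
    "T 0 = {}" "\<forall>i. T i \<subseteq> {max i (Suc c)..<c + m}" "\<forall>N\<ge>c + m. L N = xs"
    "\<forall>i. Poly_Mapping.lookup d i = card (T i)"
    using assms(1) unfolding word_chain_def by blast
  obtain T' L' where L': "L' 0 = [Suc (c + m)..<Suc (c + m + m')]"
    "\<forall>i. L' (Suc i) = list_row (T' (Suc i)) (Suc (c + m)) (L' i)"
    "T' 0 = {}" "\<forall>i. T' i \<subseteq> {max i (Suc (c + m))..<c + m + m'}" "\<forall>N\<ge>c + m + m'. L' N = ys"
    "\<forall>i. Poly_Mapping.lookup e i = card (T' i)"
    using assms(2) unfolding word_chain_def by blast
  have len: "length (L i) = m" for i by (induction i) (simp_all add: L(1,2) del: upt_Suc)
  have T: "Suc c \<le> p \<and> i \<le> p \<and> p < c + m" if "p \<in> T i" for p i using L(4) that by force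
  have T': "Suc (c + m) \<le> p \<and> i \<le> p \<and> p < c + m + m'" if "p \<in> T' i" for p i using L'(4) that by force
  have "L (Suc i) @ L' (Suc i) = list_row (T (Suc i) \<union> T' (Suc i)) (Suc c) (L i @ L' i)" for i
  proof -
    have "list_row (T (Suc i) \<union> T' (Suc i)) (Suc c) (L i @ L' i) =
        list_row (T (Suc i) \<union> T' (Suc i)) (Suc c) (L i) @
        list_row (T (Suc i) \<union> T' (Suc i)) (Suc c + length (L i)) (L' i)"
    proof (rule list_row_append)
      show "L i \<noteq> []" using assms(3) len[of i] by auto
      have "c + m \<notin> T (Suc i)" "c + m \<notin> T' (Suc i)"
        using T[of "c + m" "Suc i"] T'[of "c + m" "Suc i"] by auto
      then show "Suc c + length (L i) - 1 \<notin> T (Suc i) \<union> T' (Suc i)" by (simp add: len)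
    qed
    also have "list_row (T (Suc i) \<union> T' (Suc i)) (Suc c) (L i) = L (Suc i)"
      unfolding L(2)[rule_format]
    proof (rule list_row_cong)
      fix p assume "Suc p < Suc c + length (L i)"
      then show "p \<in> T (Suc i) \<union> T' (Suc i) \<longleftrightarrow> p \<in> T (Suc i)" using T'[of p "Suc i"] by (auto simp: len)
    qed
    also have "list_row (T (Suc i) \<union> T' (Suc i)) (Suc c + length (L i)) (L' i) = L' (Suc i)"
      unfolding L'(2)[rule_format] len add_Suc
    proof (rule list_row_cong)
      fix p assume "Suc (c + m) \<le> p"
      then show "p \<in> T (Suc i) \<union> T' (Suc i) \<longleftrightarrow> p \<in> T' (Suc i)" using T[of p "Suc i"] by auto
    qed
    finally show ?thesis by simp
  qed
  moreover have "card (T i \<union> T' i) = card (T i) + card (T' i)" for i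
  proof (rule card_Un_disjoint)
    show "finite (T i)" "finite (T' i)"
      using finite_subset[OF L(4)[rule_format]] finite_subset[OF L'(4)[rule_format]] by simp_all
    have False if "p \<in> T i" "p \<in> T' i" for p using T[OF that(1)] T'[OF that(2)] by simp
    then show "T i \<inter> T' i = {}" by blast
  qed
  moreover have "L 0 @ L' 0 = [Suc c..<Suc (c + (m + m'))]"
    unfolding L(1) L'(1) using upt_add_eq_append[of "Suc c" "Suc (c + m)" m'] by (simp add: add.assoc del: upt_Suc)
  moreover have "T i \<union> T' i \<subseteq> {max i (Suc c)..<c + (m + m')}" for i
    using L(4)[rule_format, of i] L'(4)[rule_format, of i] by (auto simp: subset_iff)
  ultimately show ?thesis
    unfolding word_chain_def using L(3,5,6) L'(3,5,6)
    by (intro exI[of _ "\<lambda>i. T i \<union> T' i"] exI[of _ "\<lambda>i. L i @ L' i"]) (simp add: lookup_add)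
qed

lemma demazure_row_below:
  assumes "k < j"
  shows "demazure_row n j T w k = w k"
proof (cases "j \<le> n")
  case True
  then show ?thesis using assms
    by (induction rule: inc_induct) (auto simp: demazure_row_empty demazure_row_step demazure_step_def)
qed (simp add: demazure_row_empty)

lemma demazure_row_above:
  assumes "n < k"
  shows "demazure_row n j T w k = w k"
proof (cases "j \<le> n")
  case True
  then show ?thesis using assms
    by (induction rule: inc_induct) (auto simp: demazure_row_empty demazure_row_step demazure_step_def)
qed (simp add: demazure_row_empty)

lemma demazure_row_skip:
  assumes "j \<le> i" "T \<inter> {j..<i} = {}"
  shows "demazure_row n j T w = demazure_row n i T w"
  using assms
proof (induction rule: inc_induct)
  case (step j)
  then have "j \<notin> T" "T \<inter> {Suc j..<i} = {}" by auto
  then show ?case using step by (cases "j < n") (simp_all add: demazure_row_step demazure_row_empty)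
qed simp

text \<open>Transfers 0-Hecke products of permutations to words.\<close>

lemma map_demazure_row:
  assumes "j \<le> n"
  shows "map (demazure_row n j T w) [j..<Suc n] = list_row T j (map w [j..<Suc n])"
  using assms
proof (induction rule: inc_induct)
  case base
  then show ?case by (simp add: demazure_row_empty)
next
  case (step j)
  let ?v = "demazure_row n (Suc j) T w"
  have upt: "[j..<Suc n] = j # Suc j # [Suc (Suc j)..<Suc n]" using step by (simp add: upt_conv_Cons)
  have upt': "[Suc j..<Suc n] = Suc j # [Suc (Suc j)..<Suc n]" using step by (simp add: upt_conv_Cons)
  have tail: "list_row T (Suc j) (map w [Suc j..<Suc n]) = ?v (Suc j) # map ?v [Suc (Suc j)..<Suc n]"
    using step.IH unfolding upt' by (simp only: list.map)
  have split: "map w [j..<Suc n] = w j # map w [Suc j..<Suc n]" unfolding upt upt' by simp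
  have "list_row T j (map w [j..<Suc n]) =
    (if j \<in> T \<and> w j < ?v (Suc j) then ?v (Suc j) # w j # map ?v [Suc (Suc j)..<Suc n]
     else w j # map ?v [Suc j..<Suc n])"
    unfolding split list_row.simps(2)[of T j "w j"] tail list.case by (simp add: upt' del: upt_Suc)
  also have "w j = ?v j" by (simp add: demazure_row_below)
  also have "(if j \<in> T \<and> ?v j < ?v (Suc j) then ?v (Suc j) # ?v j # map ?v [Suc (Suc j)..<Suc n]
     else ?v j # map ?v [Suc j..<Suc n]) = map (demazure_row n j T w) [j..<Suc n]"
    unfolding demazure_row_step[OF \<open>j < n\<close>] demazure_step_def upt upt'
    by (auto simp: transpose_def simp del: upt_Suc)
  finally show ?case by simp
qed

lemma keys_pipe_rows_word_chain:
  assumes "word_chain 0 n xs e"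
  shows "e \<in> Poly_Mapping.keys (pipe_rows n n (perm_of_word xs))"
proof -
  obtain T L where L: "L 0 = [1..<Suc n]" "\<forall>i. L (Suc i) = list_row (T (Suc i)) 1 (L i)"
    "T 0 = {}" "\<forall>i. T i \<subseteq> {max i 1..<n}" "\<forall>N\<ge>n. L N = xs"
    "\<forall>i. Poly_Mapping.lookup e i = card (T i)"
    using assms unfolding word_chain_def by (auto simp del: upt_Suc)
  define v where "v = rec_nat id (\<lambda>i w. demazure_row n (Suc i) (T (Suc i)) w)"
  have v: "v 0 = id" "v (Suc i) = demazure_row n (Suc i) (T (Suc i)) (v i)" for i by (simp_all add: v_def)
  have word: "map (v i) [1..<Suc n] = L i" for i
  proof (induction i)
    case 0
    then show ?case using L(1) by (simp add: v del: upt_Suc)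
  next
    case (Suc i)
    have "T (Suc i) \<inter> {1..<Suc i} = {}" using L(4)[rule_format, of "Suc i"] by auto
    then have "v (Suc i) = demazure_row n 1 (T (Suc i)) (v i)"
      unfolding v using demazure_row_skip[of 1 "Suc i"] by simp
    then show ?case using map_demazure_row[of 1 n "T (Suc i)" "v i"] Suc L(2)
      by (cases "n = 0") (simp_all del: upt_Suc)
  qed
  have outside: "v i k = k" if "k \<notin> {1..n}" for i k
    using that by (induction i) (auto simp: v demazure_row_above demazure_row_below)
  have xs: "map (v n) [1..<Suc n] = xs" using word[of n] L(5) by simp
  have "v n = perm_of_word xs"
  proof
    fix k
    show "v n k = perm_of_word xs k"
    proof (cases "k \<in> {1..n}")
      case True
      then have "xs ! (k - 1) = v n k" unfolding xs[symmetric] by (subst nth_map) (auto simp del: upt_Suc)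
      then show ?thesis using True word_chain_length[OF assms] by (simp add: perm_of_word_def)
    qed (use outside word_chain_length[OF assms] in \<open>auto simp: perm_of_word_def\<close>)
  qed
  moreover have "(\<Sum>i=1..n. Poly_Mapping.single i (card (T i \<inter> {i..<n}))) = e"
  proof (rule poly_mapping_eqI)
    fix k
    have "T k \<inter> {k..<n} = T k" using L(4)[rule_format, of k] by auto
    moreover have "T k = {}" if "k \<notin> {1..n}" using L(3) L(4)[rule_format, of k] that by (cases "k = 0") auto
    ultimately show "Poly_Mapping.lookup (\<Sum>i=1..n. Poly_Mapping.single i (card (T i \<inter> {i..<n}))) k = Poly_Mapping.lookup e k"
      using L(6) by (auto simp: lookup_sum lookup_single when_def)
  qed
  ultimately show ?thesis
    using keys_pipe_rows[where v = v and m = n and n = n and T = T] v by simp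
qed

section \<open>Layered permutations\<close>

fun layers :: "nat \<Rightarrow> nat list \<Rightarrow> nat list" where
  "layers c [] = []"
| "layers c (b # bs) = rev [Suc c..<Suc (c + b)] @ layers (c + b) bs"

lemma layered_word_eq_layers: "layered_word bs = layers 0 bs"
proof -
  have "concat (map (\<lambda>i. rev [Suc (c + sum_list (take i bs))..<Suc (c + sum_list (take (Suc i) bs))])
      [0..<length bs]) = layers c bs" for c
  proof (induction bs arbitrary: c)
    case (Cons b bs)
    have "[0..<length (b # bs)] = 0 # map Suc [0..<length bs]"
      by (simp add: upt_conv_Cons map_Suc_upt del: upt_Suc)
    then show ?case using Cons[of "c + b"] by (simp add: comp_def add.assoc del: upt_Suc)
  qed simp
  from this[of 0] show ?thesis by (simp add: layered_word_def)
qed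

lemma length_layers: "length (layers c bs) = sum_list bs"
  by (induction c bs rule: layers.induct) (simp_all del: upt_Suc)

lemma set_layers: "set (layers c bs) = {Suc c..c + sum_list bs}"
proof (induction c bs rule: layers.induct)
  case (2 c b bs)
  have "{Suc c..<Suc (c + b)} \<union> {Suc (c + b)..c + b + sum_list bs} = {Suc c..c + b + sum_list bs}" by auto
  then show ?case using 2 by (simp add: add.assoc del: upt_Suc)
qed simp

lemma perm_of_word_permutes:
  assumes "set xs = {1..length xs}"
  shows "perm_of_word xs permutes {1..length xs}"
proof (rule bij_imp_permutes)
  have dist: "distinct xs" using assms by (intro card_distinct) simp
  show "bij_betw (perm_of_word xs) {1..length xs} {1..length xs}"
  proof (rule bij_betw_imageI)
    show "inj_on (perm_of_word xs) {1..length xs}"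
      using dist by (auto simp: inj_on_def perm_of_word_def nth_eq_iff_index_eq)
    have "perm_of_word xs ` {1..length xs} = (!) xs ` (\<lambda>i. i - 1) ` {1..length xs}"
      unfolding image_image by (intro image_cong) (auto simp: perm_of_word_def)
    also have "(\<lambda>i. i - 1) ` {1..length xs} = {0..<length xs}"
      by (auto simp: image_iff intro!: bexI[of _ "Suc _"])
    also have "(!) xs ` {0..<length xs} = set xs" by (simp add: nth_image flip: list.set_map)
    finally show "perm_of_word xs ` {1..length xs} = {1..length xs}" using assms by simp
  qed
qed (auto simp: perm_of_word_def)

lemma word_chain_layers:
  assumes "\<forall>b\<in>set bs. 1 \<le> b" "e \<in> layered_sums c bs"
  shows "word_chain c (sum_list bs) (layers c bs) e"
  using assms
proof (induction c bs arbitrary: e rule: layers.induct)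
  case (1 c)
  then show ?case unfolding word_chain_def
    by (intro exI[of _ "\<lambda>_. {}"] exI[of _ "\<lambda>_. []"]) simp
next
  case (2 c b bs)
  then obtain d e' where "e = d + e'" "d \<in> column_sums {1..<b} (block_sets c)" "e' \<in> layered_sums (c + b) bs"
    by auto
  then show ?case
    using 2 word_chain_append[OF word_chain_block[of b d c], of "sum_list bs" "layers (c + b) bs" e'] by simp
qed

theorem layered_sums_subset_keys:
  assumes "\<forall>b\<in>set bs. 1 \<le> b" "sum_list bs = n"
  shows "layered_sums 0 bs \<subseteq> Poly_Mapping.keys (grothendieck n (layered_perm bs))"
proof
  fix e assume "e \<in> layered_sums 0 bs"
  then have "word_chain 0 n (layers 0 bs) e" using word_chain_layers assms by blast
  moreover have "perm_of_word (layers 0 bs) permutes {1..n}"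
    using perm_of_word_permutes[of "layers 0 bs"] assms(2) by (simp add: set_layers length_layers)
  ultimately show "e \<in> Poly_Mapping.keys (grothendieck n (layered_perm bs))"
    by (simp add: layered_perm_def layered_word_eq_layers grothendieck_eq_pipe_rows keys_pipe_rows_word_chain)
qed

section \<open>The support of a fireworks permutation\<close>

theorem corollary1p4:
  fixes n :: nat and w :: "nat \<Rightarrow> nat"
  assumes "w permutes {1..n}" and "fireworks n w"
  shows "Poly_Mapping.keys (grothendieck n (fireworks_layered n w))
           \<supseteq> Poly_Mapping.keys (grothendieck n w)"
proof -
  let ?bs = "map length (desc_runs (one_line n w))"
  have "\<forall>b\<in>set ?bs. 1 \<le> b" using desc_runs_nonempty by (auto simp: Suc_le_eq)
  moreover have "sum_list ?bs = n"
    using length_concat[of "desc_runs (one_line n w)"] unfolding concat_desc_runs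
    by (simp add: one_line_def del: upt_Suc)
  ultimately have "layered_sums 0 ?bs \<subseteq> Poly_Mapping.keys (grothendieck n (fireworks_layered n w))"
    unfolding fireworks_layered_def by (rule layered_sums_subset_keys)
  then show ?thesis
    using keys_grothendieck_subset[OF assms(1)] fireworks_column_sums[OF assms] by blast
qed

end
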